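(* Let $\lambda>0$ and let $A\subset\mathbb Z$ be finite and nonempty. Let $\xi$ be the Poisson field of independent simple symmetric random walks on $\mathbb Z$ with parameter $\lambda$, and for $N\in\mathbb N$ let $W_N(A)=\sum_{n=1}^N\sum_{x\in A}\xi(n,x)$ be the cumulative occupation of $A$ and let $D_N(A)$ be the number of distinct particles visiting $A$ during the times $1,\dots,N$. Put $$F_N^{(A)}=\frac{W_N(A)-\mathbb E W_N(A)}{\sqrt{\operatorname{Var}(W_N(A))}},\qquad G_N^{(A)}=\frac{D_N(A)-\mathbb E D_N(A)}{\sqrt{\operatorname{Var}(D_N(A))}},$$ and let $Z\sim\mathcal N(0,1)$. Then there exist constants $C_1,C_2>0$, depending only on $\lambda$ and $A$, such that: (a) $d_W\bigl(F_N^{(A)},Z\bigr)\le C_1N^{-1/4}$ for all $N\ge1$; (b) $d_W\bigl(G_N^{(A)},Z\bigr)\le C_2N^{-1/4}$ for all $N\ge1$.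
   Context: $\mathbb N=\{1,2,\dots\}$, $\mathbb N_0=\{0,1,2,\dots\}$. Poisson field of independent walks: let $\{\xi(0,y):y\in\mathbb Z\}$ be i.i.d. Poisson random variables with mean $\lambda$. Given these, at time $0$ place $\xi(0,y)$ particles at each $y\in\mathbb Z$; the particles perform independent simple symmetric random walks $X^{y,i}=(X^{y,i}_n)_{n\in\mathbb N_0}$ on $\mathbb Z$ with $X^{y,i}_0=y$, $1\le i\le\xi(0,y)$. Define $$\xi(n,x)=\sum_{y\in\mathbb Z}\sum_{i=1}^{\xi(0,y)}\mathbf 1_{\{X_n^{y,i}=x\}},\qquad n\in\mathbb N_0,\ x\in\mathbb Z,$$ and $$D_N(A)=\sum_{y\in\mathbb Z}\sum_{i=1}^{\xi(0,y)}\mathbf 1_{\{\exists\,1\le m\le N:\ X_m^{y,i}\in A\}}.$$ Wasserstein distance: $d_W(F,Z)=\sup\{|\mathbb E h(F)-\mathbb E h(Z)|\}$, the supremum being over all $h:\mathbb R\to\mathbb R$ that are Lipschitz with constant at most $1$. *)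

theory Defs
  imports "HOL-Probability.Probability"
begin

text \<open>Simple symmetric random walk on the integers, started at \<open>y\<close>.\<close>

definition (in prob_space) simple_symmetric_rw :: "int \<Rightarrow> (nat \<Rightarrow> 'a \<Rightarrow> int) \<Rightarrow> bool" where
  "simple_symmetric_rw y S \<longleftrightarrow>
     (\<forall>\<omega>\<in>space M. S 0 \<omega> = y) \<and>
     indep_vars (\<lambda>_. count_space UNIV) (\<lambda>n \<omega>. S (Suc n) \<omega> - S n \<omega>) UNIV \<and>
     (\<forall>n. distr M (count_space UNIV) (\<lambda>\<omega>. S (Suc n) \<omega> - S n \<omega>) =
            measure_pmf (pmf_of_set {-1, 1}))"

abbreviation path_space :: "(nat \<Rightarrow> int) measure" where
  "path_space \<equiv> Pi\<^sub>M UNIV (\<lambda>_. count_space UNIV)"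

text \<open>
  \<open>\<xi>0 y\<close> is the initial number of particles at \<open>y\<close>, and \<open>X y i n\<close> the position at time \<open>n\<close> of
  the \<open>i\<close>-th particle started at \<open>y\<close>. A walk \<open>X y i\<close> is provided for every \<open>i \<ge> 1\<close>, and the
  walks are jointly independent of \<open>\<xi>0\<close>; only those with \<open>i \<le> \<xi>0 y\<close> are particles
  of the field. The last assumption is phrased through the generated events because
  \<^const>\<open>prob_space.indep_var\<close> needs both variables to have the same type.
\<close>

locale poisson_walk_field = prob_space M
  for M :: "'w measure" +
  fixes lam :: real
    and \<xi>0 :: "int \<Rightarrow> 'w \<Rightarrow> nat"
    and X :: "int \<Rightarrow> nat \<Rightarrow> nat \<Rightarrow> 'w \<Rightarrow> int"
  assumes indep_initial: "indep_vars (\<lambda>_. count_space UNIV) \<xi>0 UNIV"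
    and poisson_initial: "\<And>y. distr M (count_space UNIV) (\<xi>0 y) = measure_pmf (poisson_pmf lam)"
    and indep_walks:
      "indep_vars (\<lambda>_. path_space) (\<lambda>(y, i) \<omega>. \<lambda>n. X y i n \<omega>) (UNIV \<times> {1..})"
    and rw_walks: "\<And>y i. i \<ge> 1 \<Longrightarrow> simple_symmetric_rw y (X y i)"
    and indep_initial_walks:
      "indep_set
         {(\<lambda>\<omega>. \<lambda>y. \<xi>0 y \<omega>) -` B \<inter> space M | B. B \<in> sets (Pi\<^sub>M UNIV (\<lambda>_. count_space UNIV))}
         {(\<lambda>\<omega>. \<lambda>(y, i) \<in> UNIV \<times> {1..}. \<lambda>n. X y i n \<omega>) -` B \<inter> space M | B.
            B \<in> sets (Pi\<^sub>M (UNIV \<times> {1..}) (\<lambda>_. path_space))}"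

text \<open>
  The sums over \<open>y\<close> below have, almost surely, only finitely many nonzero terms (a particle that is
  in a finite set by time \<open>n\<close> started within distance \<open>n\<close> of it). On the
  exceptional null set where such a sum diverges, \<^const>\<open>infsum\<close> is \<open>0\<close>.
\<close>

definition occupation ::
  "(int \<Rightarrow> 'w \<Rightarrow> nat) \<Rightarrow> (int \<Rightarrow> nat \<Rightarrow> nat \<Rightarrow> 'w \<Rightarrow> int) \<Rightarrow> nat \<Rightarrow> int \<Rightarrow> 'w \<Rightarrow> real" where
  "occupation \<xi>0 X n x \<omega> =
     (\<Sum>\<^sub>\<infinity>y\<in>UNIV. \<Sum>i = 1..\<xi>0 y \<omega>. of_bool (X y i n \<omega> = x))"

definition cumulative_occupation ::
  "(int \<Rightarrow> 'w \<Rightarrow> nat) \<Rightarrow> (int \<Rightarrow> nat \<Rightarrow> nat \<Rightarrow> 'w \<Rightarrow> int) \<Rightarrow> int set \<Rightarrow> nat \<Rightarrow> 'w \<Rightarrow> real" where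
  "cumulative_occupation \<xi>0 X A N \<omega> = (\<Sum>n = 1..N. \<Sum>x\<in>A. occupation \<xi>0 X n x \<omega>)"

definition distinct_visitors ::
  "(int \<Rightarrow> 'w \<Rightarrow> nat) \<Rightarrow> (int \<Rightarrow> nat \<Rightarrow> nat \<Rightarrow> 'w \<Rightarrow> int) \<Rightarrow> int set \<Rightarrow> nat \<Rightarrow> 'w \<Rightarrow> real" where
  "distinct_visitors \<xi>0 X A N \<omega> =
     (\<Sum>\<^sub>\<infinity>y\<in>UNIV. \<Sum>i = 1..\<xi>0 y \<omega>. of_bool (\<exists>m\<in>{1..N}. X y i m \<omega> \<in> A))"

definition (in prob_space) standardized :: "('a \<Rightarrow> real) \<Rightarrow> 'a \<Rightarrow> real" where
  "standardized V \<omega> = (V \<omega> - expectation V) / sqrt (variance V)"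

text \<open>The two random variables may live on different probability spaces.\<close>

definition wasserstein ::
  "'a measure \<Rightarrow> ('a \<Rightarrow> real) \<Rightarrow> 'b measure \<Rightarrow> ('b \<Rightarrow> real) \<Rightarrow> ereal" where
  "wasserstein M F Q Z =
     (SUP h\<in>{h :: real \<Rightarrow> real. 1-lipschitz_on UNIV h}.
        ereal \<bar>(\<integral>\<omega>. h (F \<omega>) \<partial>M) - (\<integral>\<omega>. h (Z \<omega>) \<partial>Q)\<bar>)"

end

theory Submission
  imports Defs "HOL-Real_Asymp.Real_Asymp"
begin

text \<open>
  Both functionals are sums over starting points \<open>y\<close> of independent compound Poisson variables
  \<open>T\<^sub>y = (\<Sum>i\<le>\<xi>(0,y). g(X\<^bsup>y,i\<^esup>))\<close>, where \<open>g\<close> is either the number \<open>L\<close> of visits to \<open>A\<close> up to time \<open>N\<close> or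
  the indicator of \<open>L > 0\<close>; almost surely only boundedly many \<open>y\<close> contribute. Stein's method
  bounds the Wasserstein distance by \<open>(\<Sum>y. E \<bar>T\<^sub>y - E T\<^sub>y\<bar>\<^sup>3) / \<sigma>\<^sup>3\<close>, and the compound Poisson moments reduce
  this to \<open>(\<Sum>y. E\<^sub>y g\<^sup>3) / (\<Sum>y. E\<^sub>y g\<^sup>2)\<^bsup>3/2\<^esup>\<close> up to a constant depending on the intensity.

  For \<open>g = L\<close> a first-step decomposition, summed over all \<open>y\<close>, expresses the second and third moments
  through \<open>E\<^sub>z L\<close> with \<open>z \<in> A\<close>, which is of order \<open>\<surd>N\<close> by comparison with super- and subsolutions of the
  discrete heat equation. So the moments are of order \<open>N\<^bsup>3/2\<^esup>\<close> and \<open>N\<^sup>2\<close>. For the indicator, Cauchy-Schwarz gives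
  \<open>\<Sum>y. P\<^sub>y(L > 0) \<ge> (\<Sum>y. E\<^sub>y L)\<^sup>2 / (\<Sum>y. E\<^sub>y L\<^sup>2)\<close>, which is at least of order \<open>\<surd>N\<close>.
\<close>

section \<open>Gaussian tails and the Stein equation\<close>

text \<open>The number of particles is random, so the independent summands are the sites and not the
  particles: this gives a deterministic finite index set. Only two estimates are then needed, an
  upper bound on the total third moment and a lower bound on the total second moment. For the visits
  their ratio is \<open>N^2 / (N^(3/2))^(3/2) = N^(-1/4)\<close>. For the indicator all powers
  coincide, and the ratio collapses to the power \<open>-1/2\<close> of the total hitting
  probability. No heat kernel estimate enters. Summing over all starting sites is effective because
  counting measure is invariant under a step. Behind the super- and subsolutions stands the discrete
  Tanaka formula: the mean number of visits to \<open>x\<close> at times 1 to \<open>n\<close> from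
  \<open>y\<close> is \<open>E|S_(n+1) - x| - |y - x| - 1{y = x}\<close>, so it suffices to bound
  \<open>|t|\<close> above by a square root and below by a quartic polynomial, both of which behave
  well under averaging over neighbours.\<close>

definition upper_tail :: "(real \<Rightarrow> real) \<Rightarrow> real \<Rightarrow> real" where
  "upper_tail g w = (LINT t|lborel. indicator {w..} t * g t)"

lemma integrable_indicator_atLeast_mult:
  fixes g :: "real \<Rightarrow> real"
  assumes "integrable lborel g"
  shows "integrable lborel (\<lambda>t. indicator {w..} t * g t)"
  using integrable_mult_indicator[OF _ assms, of "{w..}"] by simp

lemma upper_tail_split:
  assumes g: "integrable lborel g" "a \<le> w"
  shows "upper_tail g w = upper_tail g a - integral {a..w} g"
proof -
  have 1: "integrable lborel (\<lambda>t. indicator {a..w} t * g t)"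
    using integrable_mult_indicator[OF _ g(1), of "{a..w}"] by simp
  have "integral {a..w} g = (LINT t:{a..w}|lborel. g t)"
    using 1 by (intro set_borel_integral_eq_integral(2)[symmetric]) (simp add: set_integrable_def)
  also have "\<dots> = (LINT t|lborel. indicator {a..w} t * g t)"
    by (simp add: set_lebesgue_integral_def)
  finally have 2: "integral {a..w} g = (LINT t|lborel. indicator {a..w} t * g t)" .
  have "upper_tail g a = (LINT t|lborel. indicator {w..} t * g t + indicator {a..w} t * g t)"
    unfolding upper_tail_def
  proof (rule integral_cong_AE)
    show "AE t in lborel. indicator {a..} t * g t = indicator {w..} t * g t + indicator {a..w} t * g t"
      using AE_lborel_singleton[of w]
      by eventually_elim (use \<open>a \<le> w\<close> in \<open>auto simp: indicator_def\<close>)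
  qed (use g in measurable)
  also have "\<dots> = upper_tail g w + integral {a..w} g"
    unfolding upper_tail_def 2
    using integrable_indicator_atLeast_mult[OF g(1)] 1 by (rule Bochner_Integration.integral_add)
  finally show ?thesis by simp
qed

lemma DERIV_upper_tail:
  assumes g: "integrable lborel g" "continuous_on UNIV g"
  shows "(upper_tail g has_real_derivative - g w) (at w)"
proof -
  \<comment> \<open>Any base point left of \<open>w\<close> would serve: near \<open>w\<close> the
    tail is a constant minus an integral from \<open>a\<close>, so the fundamental theorem on a
    compact interval applies.\<close>
  define a where "a = w - 1"
  have "((\<lambda>x. integral {a..x} g) has_real_derivative g w) (at w within {a..w + 1})"
    by (rule integral_has_real_derivative)
       (use g in \<open>auto simp: a_def intro: continuous_on_subset\<close>)
  then have "((\<lambda>x. integral {a..x} g) has_real_derivative g w) (at w)"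
    by (subst (asm) at_within_interior) (auto simp: a_def)
  then have "((\<lambda>x. upper_tail g a - integral {a..x} g) has_real_derivative - g w) (at w)"
    by (auto intro!: derivative_eq_intros)
  then show ?thesis
  proof (rule has_field_derivative_transform_within_open[where S="{a<..}"])
    show "upper_tail g a - integral {a..x} g = upper_tail g x" if "x \<in> {a<..}" for x
      using upper_tail_split[OF g(1), of a x] that by simp
  qed (auto simp: a_def)
qed

lemma upper_tail_tendsto_0:
  assumes g: "integrable lborel g"
  shows "(upper_tail g \<longlongrightarrow> 0) at_top"
proof -
  have "((\<lambda>w. LINT t|lborel. indicator {w..} t * g t) \<longlongrightarrow> (LINT (t::real)|lborel. 0)) at_top"
  proof (rule integral_dominated_convergence_at_top[where s="\<lambda>w t. indicator {w..} t * g t" and f="\<lambda>_. 0" and w="\<lambda>t. \<bar>g t\<bar>"])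
    show "AE t in lborel. ((\<lambda>w. indicator {w..} t * g t) \<longlongrightarrow> 0) at_top"
    proof (rule AE_I2)
      fix t
      have "\<forall>\<^sub>F w in at_top. 0 = indicator {w..} t * g t"
        using eventually_gt_at_top[of t] by eventually_elim auto
      then show "((\<lambda>w. indicator {w..} t * g t) \<longlongrightarrow> 0) at_top"
        by (rule Lim_transform_eventually[OF tendsto_const])
    qed
  qed (use g in \<open>auto simp: indicator_def intro!: eventuallyI\<close>)
  then show ?thesis by (simp add: upper_tail_def[abs_def])
qed

text \<open>Both \<open>upper_tail g\<close> and \<open>- F\<close> have derivative
  \<open>- g\<close> and vanish at infinity.\<close>

lemma upper_tail_FTC:
  assumes g: "integrable lborel g" "continuous_on UNIV g"
    and F: "\<And>t. (F has_real_derivative g t) (at t)" "(F \<longlongrightarrow> 0) at_top"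
  shows "upper_tail g w = - F w"
proof -
  have "((\<lambda>t. upper_tail g t + F t) has_real_derivative 0) (at t)" for t
    using DERIV_upper_tail[OF g, of t] F(1)[of t] by (auto intro!: derivative_eq_intros)
  then obtain c where c: "\<And>t. upper_tail g t + F t = c"
    using has_field_derivative_zero_constant[of UNIV "\<lambda>t. upper_tail g t + F t"]
    by auto
  have "((\<lambda>t. upper_tail g t + F t) \<longlongrightarrow> 0 + 0) at_top"
    using upper_tail_tendsto_0[OF g(1)] F(2) by (rule tendsto_add)
  then have "c = 0" using c by (simp add: tendsto_const_iff)
  with c[of w] show ?thesis by simp
qed

section \<open>Gaussian moments over a half-line and the Mills ratio\<close>

abbreviation (input) gauss :: "real \<Rightarrow> real" where "gauss \<equiv> std_normal_density"

lemma DERIV_gauss: "(gauss has_real_derivative - w * gauss w) (at w)"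
proof -
  have "((\<lambda>w. c * exp (- w\<^sup>2 / 2)) has_real_derivative - w * (c * exp (- w\<^sup>2 / 2))) (at w)" for c :: real
    by (auto intro!: derivative_eq_intros)
  then show ?thesis unfolding std_normal_density_def .
qed

lemma integrable_gauss [simp]: "integrable lborel gauss"
  using integrable_std_normal_moment[of 0] by simp

lemma integral_gauss [simp]: "(LINT t|lborel. gauss t) = 1"
  using integral_std_normal_moment_even[of 0] by simp

lemma integrable_gauss_poly:
  "integrable lborel (\<lambda>t. gauss t * t)" "integrable lborel (\<lambda>t. gauss t * t\<^sup>2)"
  "integrable lborel (\<lambda>t. gauss t * \<bar>t\<bar>)"
  using integrable_std_normal_moment[of 1] integrable_std_normal_moment[of 2]
    integrable_std_normal_moment_abs[of 1] by simp_all

lemma continuous_on_gauss [continuous_intros]: "continuous_on S gauss"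
  unfolding std_normal_density_def[abs_def] by (intro continuous_intros) auto

lemma upper_tail_gauss_moment1: "upper_tail (\<lambda>t. gauss t * t) w = gauss w"
proof -
  have "upper_tail (\<lambda>t. gauss t * t) w = - (- gauss w)"
  proof (rule upper_tail_FTC[where F="\<lambda>t. - gauss t"])
    show "((\<lambda>t. - gauss t) has_real_derivative gauss t * t) (at t)" for t
      using DERIV_gauss[of t] by (auto intro!: derivative_eq_intros)
    show "((\<lambda>t. - gauss t) \<longlongrightarrow> 0) at_top"
      unfolding std_normal_density_def by real_asymp
  qed (auto intro!: continuous_intros integrable_gauss_poly)
  then show ?thesis by simp
qed

text \<open>\<open>(t^2 - 1) * gauss t\<close> has the antiderivative \<open>- t * gauss t\<close>,
  so the second moment is a boundary term plus the tail mass.\<close>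

lemma upper_tail_gauss_moment2:
  "upper_tail (\<lambda>t. gauss t * t\<^sup>2) w = w * gauss w + upper_tail gauss w"
proof -
  have "upper_tail (\<lambda>t. gauss t * t\<^sup>2 - gauss t) w = - (- w * gauss w)"
  proof (rule upper_tail_FTC[where F="\<lambda>t. - t * gauss t"])
    show "((\<lambda>t. - t * gauss t) has_real_derivative gauss t * t\<^sup>2 - gauss t) (at t)" for t
      using DERIV_gauss[of t] by (auto intro!: derivative_eq_intros simp: power2_eq_square)
    show "((\<lambda>t. - t * gauss t) \<longlongrightarrow> 0) at_top"
      unfolding std_normal_density_def by real_asymp
  qed (auto intro!: continuous_intros integrable_gauss_poly)
  moreover have "upper_tail (\<lambda>t. gauss t * t\<^sup>2 - gauss t) w
      = upper_tail (\<lambda>t. gauss t * t\<^sup>2) w - upper_tail gauss w"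
    unfolding upper_tail_def right_diff_distrib
    by (intro Bochner_Integration.integral_diff integrable_indicator_atLeast_mult
        integrable_gauss_poly integrable_gauss)
  ultimately show ?thesis by simp
qed

lemma upper_tail_mono:
  assumes "integrable lborel f" "integrable lborel g" "\<And>t. w \<le> t \<Longrightarrow> f t \<le> g t"
  shows "upper_tail f w \<le> upper_tail g w"
  unfolding upper_tail_def using assms
  by (intro integral_mono integrable_indicator_atLeast_mult) (auto simp: indicator_def)

lemma upper_tail_lincomb:
  assumes "integrable lborel f" "integrable lborel g"
  shows "upper_tail (\<lambda>t. a * f t + b * g t) w = a * upper_tail f w + b * upper_tail g w"
proof -
  have "upper_tail (\<lambda>t. a * f t + b * g t) w
     = (LINT t|lborel. a * (indicator {w..} t * f t) + b * (indicator {w..} t * g t))"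
    unfolding upper_tail_def by (simp add: algebra_simps)
  also have "\<dots> = (LINT t|lborel. a * (indicator {w..} t * f t)) + (LINT t|lborel. b * (indicator {w..} t * g t))"
    by (intro Bochner_Integration.integral_add integrable_mult_right integrable_indicator_atLeast_mult assms)
  finally show ?thesis unfolding upper_tail_def by simp
qed

lemma upper_tail_abs_le:
  assumes f: "integrable lborel f" and g: "integrable lborel g" and le: "\<And>t. w \<le> t \<Longrightarrow> \<bar>f t\<bar> \<le> g t"
  shows "\<bar>upper_tail f w\<bar> \<le> upper_tail g w"
proof -
  have "upper_tail f w \<le> upper_tail g w"
    by (rule upper_tail_mono[OF f g]) (use le in \<open>fastforce simp: abs_le_iff\<close>)
  moreover have "upper_tail (\<lambda>t. (-1) * f t + 0 * f t) w \<le> upper_tail g w"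
    by (rule upper_tail_mono) (use f g le in \<open>auto simp: abs_le_iff\<close>)
  ultimately show ?thesis
    unfolding upper_tail_lincomb[OF f f] by linarith
qed

text \<open>The tail integral of \<open>(t - w)^2\<close> against the density is nonnegative; by the
  two moments above it equals \<open>(1 + w^2) * upper_tail gauss w - w * gauss w\<close>.\<close>

lemma gauss_Mills_lower: "w * gauss w \<le> (1 + w\<^sup>2) * upper_tail gauss w"
proof -
  have "0 \<le> upper_tail (\<lambda>t. gauss t * (t - w)\<^sup>2) w"
    unfolding upper_tail_def by (intro integral_nonneg_AE AE_I2) (auto simp: indicator_def)
  also have "(\<lambda>t. gauss t * (t - w)\<^sup>2) =
     (\<lambda>t. 1 * (1 * (gauss t * t\<^sup>2) + (-2*w) * (gauss t * t)) + w\<^sup>2 * gauss t)"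
    by (simp add: fun_eq_iff power2_eq_square algebra_simps)
  also have "upper_tail \<dots> w = (w * gauss w + upper_tail gauss w) + (-2*w) * gauss w + w\<^sup>2 * upper_tail gauss w"
    by (subst upper_tail_lincomb, intro Bochner_Integration.integrable_add integrable_mult_right integrable_gauss_poly,
        simp, subst upper_tail_lincomb)
       (auto simp: upper_tail_gauss_moment1 upper_tail_gauss_moment2 intro: integrable_gauss_poly)
  finally show ?thesis by (simp add: algebra_simps)
qed

text \<open>The first bound compares \<open>w\<close> with \<open>t\<close> on the tail. It says
  nothing at \<open>w = 0\<close>, where the second, uniform one takes over.\<close>

lemma gauss_Mills_upper:
  assumes "w \<ge> 0" shows "w * upper_tail gauss w \<le> gauss w" "upper_tail gauss w \<le> 3 * gauss w"
proof -
  have "upper_tail (\<lambda>t. w * gauss t + 0 * gauss t) w \<le> upper_tail (\<lambda>t. gauss t * t) w"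
    using assms by (intro upper_tail_mono) (auto intro: integrable_gauss_poly simp: mult.commute[of w] mult_left_mono)
  then show "w * upper_tail gauss w \<le> gauss w"
    unfolding upper_tail_lincomb[OF integrable_gauss integrable_gauss] upper_tail_gauss_moment1 by simp
  have s: "sqrt (2 * pi) \<le> 3"
    using pi_less_4 by (intro real_le_lsqrt) auto
  \<comment> \<open>For \<open>t \<ge> w \<ge> 0\<close> one has
    \<open>t^2 \<ge> w^2 + (t - w)^2\<close>, so the tail lies below a multiple of the normal
    density centred at \<open>w\<close>, which has total mass 1.\<close>
  have "upper_tail gauss w \<le> (LINT t|lborel. sqrt (2*pi) * gauss w * normal_density w 1 t)"
    unfolding upper_tail_def
  proof (rule integral_mono)
    fix t
    have "gauss t \<le> sqrt (2*pi) * gauss w * normal_density w 1 t" if "w \<le> t"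
    proof -
      have "w * w \<le> w * t" using that assms by (intro mult_left_mono) auto
      then have "- t\<^sup>2/2 \<le> - w\<^sup>2/2 + - (t-w)\<^sup>2/2" by (simp add: power2_eq_square algebra_simps)
      then have "exp (- t\<^sup>2/2) \<le> exp (- w\<^sup>2/2) * exp (- (t-w)\<^sup>2/2)" by (simp add: exp_add[symmetric])
      then show ?thesis
        unfolding std_normal_density_def normal_density_def by (simp add: field_simps)
    qed
    then show "indicator {w..} t * gauss t \<le> sqrt (2*pi) * gauss w * normal_density w 1 t"
      by (auto simp: indicator_def)
  qed (auto intro!: integrable_indicator_atLeast_mult)
  also have "\<dots> = sqrt (2*pi) * gauss w" by simp
  also have "\<dots> \<le> 3 * gauss w" using s by (intro mult_right_mono) auto
  finally show "upper_tail gauss w \<le> 3 * gauss w" .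
qed

text \<open>Solutions of \<open>f' w - w * f w = h w - E h(Z)\<close> differ by multiples of
  \<open>1 / gauss\<close>; for Lipschitz \<open>h\<close> this is the bounded one.\<close>

definition stein_solution :: "(real \<Rightarrow> real) \<Rightarrow> real \<Rightarrow> real" where
  "stein_solution h w = - upper_tail (\<lambda>t. gauss t * (h t - (LINT s|lborel. gauss s * h s))) w / gauss w"

definition gauss_centred :: "(real \<Rightarrow> real) \<Rightarrow> real \<Rightarrow> real" where
  "gauss_centred h t = h t - (LINT s|lborel. gauss s * h s)"

lemma gauss_minus: "gauss (- t) = gauss t"
  by (simp add: std_normal_density_def)

lemma gauss_pos: "gauss w > 0"
  by (simp add: std_normal_density_def)

section \<open>Bounds on the Stein solution of a Lipschitz test function\<close>

context
  fixes h :: "real \<Rightarrow> real"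
  assumes lip: "1-lipschitz_on UNIV h"
begin

lemma lipschitz_abs_diff_le: "\<bar>h x - h y\<bar> \<le> \<bar>x - y\<bar>"
  using lipschitz_onD[OF lip, of x y] by (simp add: dist_real_def)

lemma lipschitz_continuous: "continuous_on UNIV h"
  using lip by (rule lipschitz_on_continuous_on)

lemma lipschitz_borel_measurable: "h \<in> borel_measurable borel"
  using lipschitz_continuous by (rule borel_measurable_continuous_onI)

lemma integrable_gauss_lipschitz: "integrable lborel (\<lambda>t. gauss t * h t)"
proof (rule Bochner_Integration.integrable_bound)
  show "integrable lborel (\<lambda>t. gauss t * \<bar>h 0\<bar> + gauss t * \<bar>t\<bar>)"
    by (intro Bochner_Integration.integrable_add integrable_mult_left integrable_gauss_poly integrable_gauss)
  have "\<bar>h t\<bar> \<le> \<bar>h 0\<bar> + \<bar>t\<bar>" for t using lipschitz_abs_diff_le[of t 0] by simp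
  then show "AE t in lborel. norm (gauss t * h t) \<le> norm (gauss t * \<bar>h 0\<bar> + gauss t * \<bar>t\<bar>)"
    by (intro AE_I2) (simp add: abs_mult distrib_left[symmetric] mult_left_mono)
qed (use lipschitz_borel_measurable in auto)

lemma integrable_gauss_centred: "integrable lborel (\<lambda>t. gauss t * gauss_centred h t)"
  unfolding gauss_centred_def right_diff_distrib
  by (intro Bochner_Integration.integrable_diff integrable_gauss_lipschitz integrable_mult_left integrable_gauss)

lemma integral_gauss_centred: "(LINT t|lborel. gauss t * gauss_centred h t) = 0"
  unfolding gauss_centred_def right_diff_distrib
  by (subst Bochner_Integration.integral_diff) (auto intro!: integrable_gauss_lipschitz)

text \<open>\<open>h t - E h(Z)\<close> is the Gaussian average of \<open>h t - h s\<close>, hence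
  at most \<open>|t| + E|Z|\<close>, and \<open>E|Z| \<le> 1/2 + E(Z^2)/2 = 1\<close>.\<close>

lemma gauss_centred_bound: "\<bar>gauss_centred h t\<bar> \<le> \<bar>t\<bar> + 1"
proof -
  have "gauss_centred h t = (LINT s|lborel. gauss s * h t) - (LINT s|lborel. gauss s * h s)"
    by (simp add: gauss_centred_def)
  also have "\<dots> = (LINT s|lborel. gauss s * h t - gauss s * h s)"
    by (rule Bochner_Integration.integral_diff[symmetric]) (auto intro!: integrable_gauss_lipschitz)
  finally have "\<bar>gauss_centred h t\<bar> = \<bar>LINT s|lborel. gauss s * h t - gauss s * h s\<bar>" by simp
  also have "\<dots> \<le> (LINT s|lborel. \<bar>gauss s * h t - gauss s * h s\<bar>)"
    by (rule integral_abs_bound)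
  also have "\<dots> \<le> (LINT s|lborel. (\<bar>t\<bar> + 1/2) * gauss s + (1/2) * (gauss s * s\<^sup>2))"
  proof (rule integral_mono)
    fix s
    have "\<bar>h t - h s\<bar> \<le> \<bar>t\<bar> + \<bar>s\<bar>" using lipschitz_abs_diff_le[of t s] by linarith
    also have "\<bar>s\<bar> \<le> 1/2 + s\<^sup>2/2" using sum_squares_bound[of "\<bar>s\<bar>" 1] by simp
    finally have "gauss s * \<bar>h t - h s\<bar> \<le> gauss s * (\<bar>t\<bar> + (1/2 + s\<^sup>2/2))" by (intro mult_left_mono) auto
    then show "\<bar>gauss s * h t - gauss s * h s\<bar> \<le> (\<bar>t\<bar> + 1/2) * gauss s + (1/2) * (gauss s * s\<^sup>2)"
      by (simp add: right_diff_distrib[symmetric] abs_mult) (simp add: algebra_simps)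
  qed (auto intro!: integrable_gauss_lipschitz Bochner_Integration.integrable_diff integrable_abs
      Bochner_Integration.integrable_add integrable_gauss_poly integrable_mult_right)
  also have "\<dots> = (\<bar>t\<bar> + 1/2) + 1/2"
    using integral_std_normal_moment_even[of 1]
    by (subst Bochner_Integration.integral_add) (auto intro!: integrable_gauss_poly)
  finally show ?thesis by simp
qed

lemma stein_solution_altdef: "stein_solution h w = - upper_tail (\<lambda>t. gauss t * gauss_centred h t) w / gauss w"
  unfolding stein_solution_def gauss_centred_def ..

lemma DERIV_stein_solution:
  "(stein_solution h has_real_derivative gauss_centred h w + w * stein_solution h w) (at w)"
proof -
  have "(upper_tail (\<lambda>t. gauss t * gauss_centred h t) has_real_derivative - (gauss w * gauss_centred h w)) (at w)"
    by (rule DERIV_upper_tail[OF integrable_gauss_centred])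
       (auto simp: gauss_centred_def intro!: continuous_intros lipschitz_continuous)
  then show ?thesis
    unfolding stein_solution_altdef[abs_def]
    using DERIV_gauss[of w] gauss_pos[of w]
    by (auto intro!: derivative_eq_intros simp: field_simps power2_eq_square)
qed

text \<open>The second quantity is \<open>w * f' w\<close> for the Stein solution \<open>f\<close>.
  Together with the bound on \<open>f\<close> it controls the derivative of \<open>w * f w\<close>,
  which is what makes \<open>f'\<close> Lipschitz.\<close>

lemma stein_solution_bounds_nonneg:
  assumes w: "w \<ge> 0"
  shows "\<bar>stein_solution h w\<bar> \<le> 4" "\<bar>w * (gauss_centred h w + w * stein_solution h w)\<bar> \<le> 3"
proof -
  let ?Q = "upper_tail gauss w" and ?G = "upper_tail (\<lambda>t. gauss t * gauss_centred h t) w"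
  have "\<bar>?G\<bar> \<le> upper_tail (\<lambda>t. 1 * (gauss t * t) + 1 * gauss t) w"
  proof (rule upper_tail_abs_le)
    fix t assume "w \<le> t"
    with w have "\<bar>gauss_centred h t\<bar> \<le> t + 1" using gauss_centred_bound[of t] by simp
    then have "gauss t * \<bar>gauss_centred h t\<bar> \<le> gauss t * (t + 1)" by (intro mult_left_mono) auto
    then show "\<bar>gauss t * gauss_centred h t\<bar> \<le> 1 * (gauss t * t) + 1 * gauss t"
      by (simp add: abs_mult algebra_simps)
  qed (auto intro!: integrable_gauss_centred integrable_gauss_poly)
  also have "\<dots> = gauss w + ?Q"
    by (subst upper_tail_lincomb) (auto intro: integrable_gauss_poly simp: upper_tail_gauss_moment1)
  also have "\<dots> \<le> 4 * gauss w" using gauss_Mills_upper[OF w] by simp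
  finally show "\<bar>stein_solution h w\<bar> \<le> 4"
    using gauss_pos[of w] by (simp add: stein_solution_altdef abs_divide field_simps)

  \<comment> \<open>Freezing the centred function at its value at \<open>w\<close> costs at most
    \<open>d\<close>, the tail integral of \<open>t - w\<close>. The lower Mills bound gives
    \<open>d \<le> gauss w / (1 + w^2)\<close>, a gain that pays for the factor
    \<open>w * (2 * w + 1)\<close> collected below.\<close>
  define d where "d = gauss w - w * ?Q"
  have d0: "d \<ge> 0" using gauss_Mills_upper[OF w] by (simp add: d_def)
  have d1: "(1 + w\<^sup>2) * d \<le> gauss w"
    using mult_left_mono[OF gauss_Mills_lower w] by (simp add: d_def algebra_simps power2_eq_square)
  have "\<bar>upper_tail (\<lambda>t. 1 * (gauss t * gauss_centred h t) + (- gauss_centred h w) * gauss t) w\<bar>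
      \<le> upper_tail (\<lambda>t. 1 * (gauss t * t) + (-w) * gauss t) w"
  proof (rule upper_tail_abs_le)
    fix t assume "w \<le> t"
    then have "\<bar>gauss_centred h t - gauss_centred h w\<bar> \<le> t - w" using lipschitz_abs_diff_le[of t w] by (simp add: gauss_centred_def)
    then have "gauss t * \<bar>gauss_centred h t - gauss_centred h w\<bar> \<le> gauss t * (t - w)" by (intro mult_left_mono) auto
    moreover have "\<bar>1 * (gauss t * gauss_centred h t) + (- gauss_centred h w) * gauss t\<bar> = gauss t * \<bar>gauss_centred h t - gauss_centred h w\<bar>"
      by (simp add: mult.commute[of _ "gauss t"] right_diff_distrib[symmetric] abs_mult)
    ultimately show "\<bar>1 * (gauss t * gauss_centred h t) + (- gauss_centred h w) * gauss t\<bar> \<le> 1 * (gauss t * t) + (-w) * gauss t"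
      by (simp add: algebra_simps)
  qed (auto intro!: integrable_gauss_centred integrable_gauss_poly Bochner_Integration.integrable_diff)
  also have "\<dots> = d"
    by (subst upper_tail_lincomb) (auto intro: integrable_gauss_poly simp: upper_tail_gauss_moment1 d_def)
  finally have e: "\<bar>?G - gauss_centred h w * ?Q\<bar> \<le> d"
    by (subst (asm) upper_tail_lincomb) (auto intro: integrable_gauss_centred)
  have "gauss w * (gauss_centred h w + w * stein_solution h w) = gauss_centred h w * d - w * (?G - gauss_centred h w * ?Q)"
    using gauss_pos[of w] by (simp add: stein_solution_altdef d_def field_simps)
  then have "gauss w * \<bar>gauss_centred h w + w * stein_solution h w\<bar>
      = \<bar>gauss_centred h w * d - w * (?G - gauss_centred h w * ?Q)\<bar>"
    using gauss_pos[of w] by (metis abs_mult abs_of_pos)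
  also have "\<dots> \<le> \<bar>gauss_centred h w * d\<bar> + \<bar>w * (?G - gauss_centred h w * ?Q)\<bar>"
    by (rule abs_triangle_ineq4)
  also have "\<dots> = \<bar>gauss_centred h w\<bar> * d + w * \<bar>?G - gauss_centred h w * ?Q\<bar>"
    by (simp only: abs_mult abs_of_nonneg[OF w] abs_of_nonneg[OF d0])
  also have "\<dots> \<le> (w + 1) * d + w * d"
    using gauss_centred_bound[of w] w d0 e by (intro add_mono mult_mono) auto
  finally have e2: "gauss w * \<bar>gauss_centred h w + w * stein_solution h w\<bar> \<le> (2*w+1) * d"
    by (simp add: abs_mult algebra_simps)
  have "gauss w * \<bar>w * (gauss_centred h w + w * stein_solution h w)\<bar> = w * (gauss w * \<bar>gauss_centred h w + w * stein_solution h w\<bar>)"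
    using w by (simp add: abs_mult)
  also have "\<dots> \<le> w * ((2*w+1) * d)" by (intro mult_left_mono e2 w)
  also have "\<dots> = (2 * w\<^sup>2 + w) * d" by (simp add: power2_eq_square algebra_simps)
  also have "\<dots> \<le> (3 * (1 + w\<^sup>2)) * d"
  proof (rule mult_right_mono[OF _ d0])
    have "w \<le> 1 + w\<^sup>2" using sum_squares_bound[of w 1] w by simp
    then show "2 * w\<^sup>2 + w \<le> 3 * (1 + w\<^sup>2)" by simp
  qed
  also have "\<dots> \<le> gauss w * 3" using d1 by (simp only: mult.assoc)
  finally have "gauss w * \<bar>w * (gauss_centred h w + w * stein_solution h w)\<bar> \<le> gauss w * 3" .
  then show "\<bar>w * (gauss_centred h w + w * stein_solution h w)\<bar> \<le> 3"
    by (rule mult_left_le_imp_le) (rule gauss_pos)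
qed

end

lemma lipschitz_on_reflect:
  assumes "1-lipschitz_on UNIV (h :: real \<Rightarrow> real)"
  shows "1-lipschitz_on UNIV (\<lambda>x. h (- x))"
proof (rule lipschitz_onI)
  show "dist (h (- x)) (h (- y)) \<le> 1 * dist x y" for x y
    using lipschitz_onD[OF assms, of "- x" "- y"] by (simp add: dist_minus)
qed simp

lemma gauss_centred_reflect: "gauss_centred (\<lambda>x. h (- x)) w = gauss_centred h (- w)"
  using lborel_integral_real_affine[of "-1" "\<lambda>t. gauss t * h t" 0]
  by (simp add: gauss_minus gauss_centred_def)

text \<open>Substituting \<open>- t\<close> turns the upper tail into a lower tail; as the centred
  integrand has total integral 0, that is minus the upper tail at \<open>- w\<close>. Negative
  arguments thus inherit the bounds for nonnegative ones.\<close>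

lemma stein_solution_reflect:
  assumes lip: "1-lipschitz_on UNIV h"
  shows "stein_solution (\<lambda>x. h (- x)) w = - stein_solution h (- w)"
proof -
  let ?g = "\<lambda>t. gauss t * gauss_centred h t"
  note [measurable] = lipschitz_borel_measurable[OF lip]
  have [measurable]: "gauss_centred h \<in> borel_measurable borel"
    by (simp add: gauss_centred_def[abs_def])
  have int: "integrable lborel (\<lambda>t. indicator {..- w} t * ?g t)"
    using integrable_mult_indicator[OF _ integrable_gauss_centred[OF lip], of "{..- w}"] by simp
  have "upper_tail (\<lambda>t. gauss t * gauss_centred (\<lambda>x. h (- x)) t) w
      = (LINT t|lborel. indicator {w..} (- t) * ?g t)"
    unfolding upper_tail_def gauss_centred_reflect
    by (subst lborel_integral_real_affine[of "-1" _ 0]) (simp_all add: gauss_minus)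
  also have "\<dots> = (LINT t|lborel. indicator {..- w} t * ?g t)"
    by (intro Bochner_Integration.integral_cong) (auto simp: indicator_def)
  finally have 1: "upper_tail (\<lambda>t. gauss t * gauss_centred (\<lambda>x. h (- x)) t) w
     = (LINT t|lborel. indicator {..- w} t * ?g t)" .
  have "0 = (LINT t|lborel. ?g t)" by (simp add: integral_gauss_centred[OF lip])
  also have "\<dots> = (LINT t|lborel. indicator {..- w} t * ?g t + indicator {- w..} t * ?g t)"
  proof (rule integral_cong_AE)
    show "AE t in lborel. ?g t = indicator {..- w} t * ?g t + indicator {- w..} t * ?g t"
      using AE_lborel_singleton[of "-w"]
      by eventually_elim (auto simp: indicator_def)
  qed measurable
  also have "\<dots> = (LINT t|lborel. indicator {..- w} t * ?g t) + upper_tail ?g (- w)"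
    unfolding upper_tail_def
    by (intro Bochner_Integration.integral_add int integrable_indicator_atLeast_mult integrable_gauss_centred[OF lip])
  finally have "0 = (LINT t|lborel. indicator {..- w} t * ?g t) + upper_tail ?g (- w)" .
  then show ?thesis
    unfolding stein_solution_altdef[OF lip] stein_solution_altdef[OF lipschitz_on_reflect[OF lip]] 1
    using gauss_pos[of w] by (simp add: gauss_minus field_simps)
qed

lemma stein_solution_bounds:
  assumes lip: "1-lipschitz_on UNIV h"
  shows "\<bar>stein_solution h w\<bar> \<le> 4 \<and> \<bar>w * (gauss_centred h w + w * stein_solution h w)\<bar> \<le> 3"
proof (cases "w \<ge> 0")
  case True
  then show ?thesis using stein_solution_bounds_nonneg[OF lip] by blast
next
  case False
  with False show ?thesis
    using stein_solution_bounds_nonneg[OF lipschitz_on_reflect[OF lip], of "- w"]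
    unfolding stein_solution_reflect[OF lip] gauss_centred_reflect minus_minus abs_minus_cancel mult_minus_left
    by simp
qed

text \<open>\<open>h\<close> need not be differentiable, so \<open>f'\<close> gets a Lipschitz
  constant in place of a bounded second derivative: it is the centred \<open>h\<close>, with
  constant 1, plus \<open>w * f w\<close>, whose derivative is bounded by 4 + 3.\<close>

lemma stein_equation:
  assumes lip: "1-lipschitz_on UNIV h"
  obtains f f' :: "real \<Rightarrow> real"
  where "\<And>w. (f has_real_derivative f' w) (at w)"
    and "\<And>w. f' w - w * f w = h w - (LINT s|lborel. gauss s * h s)"
    and "\<And>w. \<bar>f w\<bar> \<le> 4"
    and "8-lipschitz_on UNIV f'"
proof
  let ?f = "stein_solution h" and ?f' = "\<lambda>w. gauss_centred h w + w * stein_solution h w"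
  show D: "(?f has_real_derivative ?f' w) (at w)" for w
    by (rule DERIV_stein_solution[OF lip])
  show "?f' w - w * ?f w = h w - (LINT s|lborel. gauss s * h s)" for w
    by (simp add: gauss_centred_def)
  show "\<bar>?f w\<bar> \<le> 4" for w using stein_solution_bounds[OF lip] by blast
  show "8-lipschitz_on UNIV ?f'"
  proof (rule lipschitz_onI)
    fix x y :: real
    have "norm (x * ?f x - y * ?f y) \<le> 7 * norm (x - y)"
    proof (rule field_differentiable_bound[where S=UNIV and f'="\<lambda>w. ?f w + w * ?f' w"])
      show "((\<lambda>w. w * ?f w) has_field_derivative ?f w + w * ?f' w) (at w within UNIV)" for w
        using D[of w] by (auto intro!: derivative_eq_intros)
      show "norm (?f w + w * ?f' w) \<le> 7" for w
        using stein_solution_bounds[OF lip, of w] by (simp add: abs_le_iff)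
    qed auto
    moreover have triangle_sum: "\<bar>a + p - (b + q)\<bar> \<le> 8 * d"
      if "\<bar>p - q\<bar> \<le> 7 * d" "\<bar>a - b\<bar> \<le> d" for a b p q d :: real
      using that by linarith
    moreover have "\<bar>gauss_centred h x - gauss_centred h y\<bar> \<le> \<bar>x - y\<bar>"
      using lipschitz_abs_diff_le[OF lip, of x y] by (simp add: gauss_centred_def)
    ultimately show "dist (?f' x) (?f' y) \<le> 8 * dist x y"
      using triangle_sum unfolding dist_real_def real_norm_def by blast
  qed simp
qed

section \<open>Stein's method for independent sums\<close>

lemma abs_power_le_one_plus_cube:
  fixes y :: real assumes "k \<le> 3" shows "\<bar>y\<bar> ^ k \<le> 1 + \<bar>y\<bar> ^ 3"
proof (cases "\<bar>y\<bar> \<le> 1")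
  case True then have "\<bar>y\<bar> ^ k \<le> 1" by (simp add: power_le_one)
  then show ?thesis by (simp add: add_increasing2)
next
  case False then have "\<bar>y\<bar> ^ k \<le> \<bar>y\<bar> ^ 3" using assms by (intro power_increasing) auto
  then show ?thesis by simp
qed

context prob_space begin

lemma integrable_lower_power:
  fixes Y :: "'a \<Rightarrow> real"
  assumes [measurable]: "random_variable borel Y" and int: "integrable M (\<lambda>\<omega>. \<bar>Y \<omega>\<bar> ^ 3)" and "k \<le> 3"
  shows "integrable M (\<lambda>\<omega>. \<bar>Y \<omega>\<bar> ^ k)"
proof (rule Bochner_Integration.integrable_bound)
  show "integrable M (\<lambda>\<omega>. 1 + \<bar>Y \<omega>\<bar> ^ 3)" using int by auto
  show "AE \<omega> in M. norm (\<bar>Y \<omega>\<bar> ^ k) \<le> norm (1 + \<bar>Y \<omega>\<bar> ^ 3)"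
    using abs_power_le_one_plus_cube[OF \<open>k \<le> 3\<close>] by (auto intro!: AE_I2)
qed simp

text \<open>Jensen's inequality by the tangent of the cube at the mean \<open>m\<close>:
  \<open>(s - m)^2 * (s + 2 * m) \<ge> 0\<close>.\<close>

lemma cube_expectation_le:
  assumes [measurable]: "random_variable borel S" and S: "\<And>\<omega>. S \<omega> \<ge> 0"
    and int: "integrable M S" "integrable M (\<lambda>\<omega>. S \<omega> ^ 3)"
  shows "expectation S ^ 3 \<le> expectation (\<lambda>\<omega>. S \<omega> ^ 3 :: real)"
proof -
  define m where "m = expectation S"
  have m: "m \<ge> 0" using S by (simp add: m_def)
  have "0 \<le> expectation (\<lambda>\<omega>. (S \<omega> ^ 3 + 2 * m ^ 3) - 3 * m\<^sup>2 * S \<omega>)"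
  proof (rule integral_nonneg_AE, rule AE_I2)
    fix \<omega>
    have "0 \<le> (S \<omega> - m)\<^sup>2 * (S \<omega> + 2 * m)" using S[of \<omega>] m by simp
    also have "\<dots> = (S \<omega> ^ 3 + 2 * m ^ 3) - 3 * m\<^sup>2 * S \<omega>"
      by (simp add: power2_eq_square power3_eq_cube algebra_simps)
    finally show "0 \<le> (S \<omega> ^ 3 + 2 * m ^ 3) - 3 * m\<^sup>2 * S \<omega>" .
  qed
  also have "\<dots> = expectation (\<lambda>\<omega>. S \<omega> ^ 3) + 2 * m ^ 3 - 3 * m\<^sup>2 * m"
    using int by (simp add: prob_space m_def)
  finally show ?thesis by (simp add: m_def power2_eq_square power3_eq_cube)
qed

text \<open>With \<open>m\<close> the mean of \<open>|Y|\<close>, averaging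
  \<open>(|Y| - m)^2 * (2 * |Y| + m) \<ge> 0\<close> bounds \<open>3 * m * E(Y^2)\<close> by
  \<open>2 * E|Y|^3 + m^3\<close>, and \<open>m^3 \<le> E|Y|^3\<close>.\<close>

lemma expectation_square_mult_abs_le:
  fixes Y :: "'a \<Rightarrow> real"
  assumes [measurable]: "random_variable borel Y" and int: "integrable M (\<lambda>\<omega>. \<bar>Y \<omega>\<bar> ^ 3)"
  shows "expectation (\<lambda>\<omega>. (Y \<omega>)\<^sup>2) * expectation (\<lambda>\<omega>. \<bar>Y \<omega>\<bar>) \<le> expectation (\<lambda>\<omega>. \<bar>Y \<omega>\<bar> ^ 3)"
proof -
  note i = integrable_lower_power[OF assms]
  have i1: "integrable M (\<lambda>\<omega>. \<bar>Y \<omega>\<bar>)" using i[of 1] by simp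
  have i2: "integrable M (\<lambda>\<omega>. (Y \<omega>)\<^sup>2)" using i[of 2] by simp
  define m where "m = expectation (\<lambda>\<omega>. \<bar>Y \<omega>\<bar>)"
  have m0: "m \<ge> 0" unfolding m_def by simp
  have "0 \<le> expectation (\<lambda>\<omega>. (2 * \<bar>Y \<omega>\<bar> ^ 3 + m ^ 3) - 3 * m * (Y \<omega>)\<^sup>2)"
  proof (rule integral_nonneg_AE, rule AE_I2)
    fix \<omega>
    have "0 \<le> (\<bar>Y \<omega>\<bar> - m)\<^sup>2 * (2 * \<bar>Y \<omega>\<bar> + m)" using m0 by simp
    also have "\<dots> = (2 * \<bar>Y \<omega>\<bar> ^ 3 + m ^ 3) - 3 * m * (Y \<omega>)\<^sup>2"
      unfolding power2_abs[of "Y \<omega>", symmetric] by (simp add: power2_eq_square power3_eq_cube algebra_simps)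
    finally show "0 \<le> (2 * \<bar>Y \<omega>\<bar> ^ 3 + m ^ 3) - 3 * m * (Y \<omega>)\<^sup>2" .
  qed
  also have "\<dots> = 2 * expectation (\<lambda>\<omega>. \<bar>Y \<omega>\<bar> ^ 3) + m ^ 3 - 3 * m * expectation (\<lambda>\<omega>. (Y \<omega>)\<^sup>2)"
    using int i2 by (simp add: prob_space)
  finally have a: "3 * m * expectation (\<lambda>\<omega>. (Y \<omega>)\<^sup>2) \<le> 2 * expectation (\<lambda>\<omega>. \<bar>Y \<omega>\<bar> ^ 3) + m ^ 3" by simp
  have "m ^ 3 \<le> expectation (\<lambda>\<omega>. \<bar>Y \<omega>\<bar> ^ 3)"
    unfolding m_def by (rule cube_expectation_le) (use i1 int in auto)
  with a show ?thesis by (simp add: m_def[symmetric] mult.commute)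
qed

text \<open>Leave-one-out argument: \<open>V i\<close>, the sum without \<open>Y i\<close>, is
  independent of \<open>Y i\<close>. Expanding \<open>f\<close> at \<open>V i\<close> costs
  \<open>8 * E|Y i|^3\<close>, and returning from \<open>f' (V i)\<close> to \<open>f' (W)\<close>
  costs the same again, whence 16.\<close>

lemma stein_bound_indep_sum:
  fixes Y :: "'i \<Rightarrow> 'a \<Rightarrow> real" and h :: "real \<Rightarrow> real"
  assumes I: "finite I" and ind: "indep_vars (\<lambda>_. borel) Y I"
    and int3: "\<And>i. i \<in> I \<Longrightarrow> integrable M (\<lambda>\<omega>. \<bar>Y i \<omega>\<bar> ^ 3)"
    and mean: "\<And>i. i \<in> I \<Longrightarrow> expectation (Y i) = 0"
    and var: "(\<Sum>i\<in>I. expectation (\<lambda>\<omega>. (Y i \<omega>)\<^sup>2)) = 1"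
    and h: "1-lipschitz_on UNIV h"
  shows "\<bar>expectation (\<lambda>\<omega>. h (\<Sum>i\<in>I. Y i \<omega>)) - (LINT s|lborel. gauss s * h s)\<bar>
    \<le> 16 * (\<Sum>i\<in>I. expectation (\<lambda>\<omega>. \<bar>Y i \<omega>\<bar> ^ 3))"
proof -
  obtain f f' :: "real \<Rightarrow> real" where D: "\<And>w. (f has_real_derivative f' w) (at w)"
    and eq: "\<And>w. f' w - w * f w = h w - (LINT s|lborel. gauss s * h s)"
    and fb: "\<And>w. \<bar>f w\<bar> \<le> 4" and lip: "8-lipschitz_on UNIV f'"
    by (rule stein_equation[OF h]) (rule that)
  have f'lip: "\<bar>f' x - f' y\<bar> \<le> 8 * \<bar>x - y\<bar>" for x y
    using lipschitz_onD[OF lip, of x y] by (simp add: dist_real_def)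
  have [measurable]: "f \<in> borel_measurable borel"
    using D by (intro borel_measurable_continuous_onI DERIV_continuous_on) (auto intro: has_field_derivative_at_within)
  have [measurable]: "f' \<in> borel_measurable borel"
    using lip by (intro borel_measurable_continuous_onI lipschitz_on_continuous_on)
  have Ym: "i \<in> I \<Longrightarrow> random_variable borel (Y i)" for i
    using ind by (simp add: indep_vars_def)
  note ik = integrable_lower_power[OF Ym int3]
  have i1: "integrable M (Y i)" if "i \<in> I" for i
    using ik[OF that that, of 1] Ym[OF that] by (simp add: integrable_abs_iff)
  have i1a: "integrable M (\<lambda>\<omega>. \<bar>Y i \<omega>\<bar>)" if "i \<in> I" for i
    using ik[OF that that, of 1] by simp
  have i2: "integrable M (\<lambda>\<omega>. (Y i \<omega>)\<^sup>2)" if "i \<in> I" for i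
    using ik[OF that that, of 2] by simp
  define W where "W = (\<lambda>\<omega>. \<Sum>i\<in>I. Y i \<omega>)"
  define V where "V = (\<lambda>i \<omega>. \<Sum>j\<in>I - {i}. Y j \<omega>)"
  have Wm [measurable]: "random_variable borel W" unfolding W_def using Ym by auto
  have Wi: "integrable M W" unfolding W_def using i1 by auto
  have Vm: "random_variable borel (V i)" for i unfolding V_def using Ym by auto
  have Vi: "integrable M (V i)" for i unfolding V_def using i1 by auto
  have f'int: "integrable M (\<lambda>\<omega>. f' (U \<omega>))" if U: "integrable M U" for U
  proof (rule Bochner_Integration.integrable_bound)
    show "integrable M (\<lambda>\<omega>. \<bar>f' 0\<bar> + 8 * \<bar>U \<omega>\<bar>)" using U by auto
    have "\<bar>f' x\<bar> \<le> \<bar>f' 0\<bar> + 8 * \<bar>x\<bar>" for x using f'lip[of x 0] by simp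
    then show "AE \<omega> in M. norm (f' (U \<omega>)) \<le> norm (\<bar>f' 0\<bar> + 8 * \<bar>U \<omega>\<bar>)"
      by (auto intro!: AE_I2 simp del: abs_add_abs intro: order_trans[OF _ abs_ge_self])
  qed (use U in measurable)
  have fint: "integrable M (\<lambda>\<omega>. U \<omega> * f (T \<omega>))" if U: "integrable M U" "random_variable borel T" for U T
  proof (rule Bochner_Integration.integrable_bound)
    show "integrable M (\<lambda>\<omega>. 4 * \<bar>U \<omega>\<bar>)" using U by auto
    show "AE \<omega> in M. norm (U \<omega> * f (T \<omega>)) \<le> norm (4 * \<bar>U \<omega>\<bar>)"
      using fb by (auto intro!: AE_I2 mult_right_mono simp: abs_mult mult.commute[of 4] intro: mult_left_mono)
  qed (use U in measurable)

  have term_bound: "\<bar>expectation (\<lambda>\<omega>. (Y i \<omega>)\<^sup>2) * expectation (\<lambda>\<omega>. f' (W \<omega>)) - expectation (\<lambda>\<omega>. Y i \<omega> * f (W \<omega>))\<bar>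
      \<le> 16 * expectation (\<lambda>\<omega>. \<bar>Y i \<omega>\<bar> ^ 3)" if i: "i \<in> I" for i
  proof -
    note [measurable] = Ym[OF i] Vm[of i]
    have WV: "W \<omega> = V i \<omega> + Y i \<omega>" for \<omega>
      unfolding W_def V_def using I i by (simp add: sum.remove add.commute)
    have indV: "indep_var borel (Y i) borel (V i)"
      unfolding V_def using I i ind by (intro indep_vars_sum) (auto simp: insert_absorb)
    have "indep_var borel ((\<lambda>x. x) \<circ> Y i) borel (f \<circ> V i)"
      by (rule indep_var_compose[OF indV]) auto
    then have "expectation (\<lambda>\<omega>. ((\<lambda>x. x) \<circ> Y i) \<omega> * (f \<circ> V i) \<omega>)
        = expectation ((\<lambda>x. x) \<circ> Y i) * expectation (f \<circ> V i)"
    proof (rule indep_var_lebesgue_integral)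
      show "integrable M (f \<circ> V i)"
        by (rule integrable_const_bound[where B=4]) (use fb in auto)
    qed (use i1[OF i] in \<open>auto simp: comp_def\<close>)
    \<comment> \<open>Independence and mean zero remove the term of order zero in the expansion at
      \<open>V i\<close>.\<close>
    then have z: "expectation (\<lambda>\<omega>. Y i \<omega> * f (V i \<omega>)) = 0"
      using mean[OF i] by (simp add: comp_def)
    have indV2: "indep_var borel ((\<lambda>x. x\<^sup>2) \<circ> Y i) borel (f' \<circ> V i)"
      by (rule indep_var_compose[OF indV]) auto
    have "expectation (\<lambda>\<omega>. ((\<lambda>x. x\<^sup>2) \<circ> Y i) \<omega> * (f' \<circ> V i) \<omega>)
        = expectation ((\<lambda>x. x\<^sup>2) \<circ> Y i) * expectation (f' \<circ> V i)"
      by (rule indep_var_lebesgue_integral[OF indV2]) (use i2[OF i] f'int[OF Vi] in \<open>auto simp: comp_def\<close>)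
    then have p: "expectation (\<lambda>\<omega>. (Y i \<omega>)\<^sup>2 * f' (V i \<omega>))
        = expectation (\<lambda>\<omega>. (Y i \<omega>)\<^sup>2) * expectation (\<lambda>\<omega>. f' (V i \<omega>))"
      by (simp add: comp_def)
    have "integrable M (\<lambda>\<omega>. ((\<lambda>x. x\<^sup>2) \<circ> Y i) \<omega> * (f' \<circ> V i) \<omega>)"
      by (rule indep_var_integrable[OF indV2]) (use i2[OF i] f'int[OF Vi] in \<open>auto simp: comp_def\<close>)
    then have pi: "integrable M (\<lambda>\<omega>. (Y i \<omega>)\<^sup>2 * f' (V i \<omega>))" by (simp add: comp_def)
    \<comment> \<open>First-order expansion without a second derivative: the mean value theorem
      yields \<open>f' z\<close> with \<open>z\<close> within \<open>|y|\<close> of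
      \<open>a\<close>, and 8 is the Lipschitz constant of \<open>f'\<close>.\<close>
    have taylor: "\<bar>f (a + y) - f a - y * f' a\<bar> \<le> 8 * y\<^sup>2" for a y
    proof -
      have "\<exists>z. \<bar>z - a\<bar> \<le> \<bar>y\<bar> \<and> f (a + y) - f a = y * f' z"
      proof (cases y "0 :: real" rule: linorder_cases)
        case less
        from MVT2[of "a + y" a f f'] D less obtain z where "a + y < z" "z < a" "f a - f (a + y) = (a - (a + y)) * f' z" by auto
        then show ?thesis by (intro exI[of _ z]) auto
      next
        case greater
        from MVT2[of a "a + y" f f'] D greater obtain z where "a < z" "z < a + y" "f (a + y) - f a = (a + y - a) * f' z" by auto
        then show ?thesis by (intro exI[of _ z]) auto
      qed (auto intro!: exI[of _ a])
      then obtain z where z: "\<bar>z - a\<bar> \<le> \<bar>y\<bar>" "f (a + y) - f a = y * f' z" by blast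
      have "\<bar>y * (f' z - f' a)\<bar> \<le> \<bar>y\<bar> * (8 * \<bar>y\<bar>)"
        unfolding abs_mult using f'lip[of z a] z(1) by (intro mult_left_mono) auto
      then show ?thesis unfolding z(2) by (simp add: algebra_simps power2_eq_square)
    qed
    have a1: "\<bar>expectation (\<lambda>\<omega>. Y i \<omega> * f (W \<omega>)) - expectation (\<lambda>\<omega>. (Y i \<omega>)\<^sup>2) * expectation (\<lambda>\<omega>. f' (V i \<omega>))\<bar>
       \<le> 8 * expectation (\<lambda>\<omega>. \<bar>Y i \<omega>\<bar> ^ 3)"
    proof -
      have e: "expectation (\<lambda>\<omega>. Y i \<omega> * f (W \<omega>) - Y i \<omega> * f (V i \<omega>) - (Y i \<omega>)\<^sup>2 * f' (V i \<omega>))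
        = expectation (\<lambda>\<omega>. Y i \<omega> * f (W \<omega>)) - expectation (\<lambda>\<omega>. (Y i \<omega>)\<^sup>2) * expectation (\<lambda>\<omega>. f' (V i \<omega>))"
        using fint[OF i1[OF i] Wm] fint[OF i1[OF i] Vm[of i]] pi z p by simp
      have "\<bar>expectation (\<lambda>\<omega>. Y i \<omega> * f (W \<omega>) - Y i \<omega> * f (V i \<omega>) - (Y i \<omega>)\<^sup>2 * f' (V i \<omega>))\<bar>
        \<le> expectation (\<lambda>\<omega>. 8 * \<bar>Y i \<omega>\<bar> ^ 3)"
      proof (rule order_trans[OF integral_abs_bound], rule integral_mono)
        fix \<omega>
        have "\<bar>Y i \<omega> * (f (V i \<omega> + Y i \<omega>) - f (V i \<omega>) - Y i \<omega> * f' (V i \<omega>))\<bar> \<le> \<bar>Y i \<omega>\<bar> * (8 * (Y i \<omega>)\<^sup>2)"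
          unfolding abs_mult[of "Y i \<omega>"] by (intro mult_left_mono taylor) auto
        also have "\<dots> = 8 * \<bar>Y i \<omega>\<bar> ^ 3"
          unfolding power2_abs[of "Y i \<omega>", symmetric] by (simp add: power3_eq_cube power2_eq_square)
        finally show "\<bar>Y i \<omega> * f (W \<omega>) - Y i \<omega> * f (V i \<omega>) - (Y i \<omega>)\<^sup>2 * f' (V i \<omega>)\<bar> \<le> 8 * \<bar>Y i \<omega>\<bar> ^ 3"
          unfolding WV by (simp add: power2_eq_square right_diff_distrib mult.assoc)
      qed (use fint[OF i1[OF i] Wm] fint[OF i1[OF i] Vm[of i]] pi int3[OF i] in auto)
      then show ?thesis unfolding e by simp
    qed
    \<comment> \<open>Here \<open>E(Y i ^ 2)\<close> is a constant factor, so only the two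
      expectations of \<open>f'\<close> need to be close; the product of moments that results is
      absorbed into the third moment.\<close>
    have "\<bar>expectation (\<lambda>\<omega>. f' (W \<omega>) - f' (V i \<omega>))\<bar> \<le> expectation (\<lambda>\<omega>. 8 * \<bar>Y i \<omega>\<bar>)"
    proof (rule order_trans[OF integral_abs_bound], rule integral_mono)
      show "\<bar>f' (W \<omega>) - f' (V i \<omega>)\<bar> \<le> 8 * \<bar>Y i \<omega>\<bar>" for \<omega>
        using f'lip[of "W \<omega>" "V i \<omega>"] by (simp add: WV)
    qed (use f'int[OF Wi] f'int[OF Vi] i1a[OF i] in auto)
    then have "\<bar>expectation (\<lambda>\<omega>. f' (W \<omega>)) - expectation (\<lambda>\<omega>. f' (V i \<omega>))\<bar> \<le> 8 * expectation (\<lambda>\<omega>. \<bar>Y i \<omega>\<bar>)"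
      using f'int[OF Wi] f'int[OF Vi] by simp
    then have "expectation (\<lambda>\<omega>. (Y i \<omega>)\<^sup>2) * \<bar>expectation (\<lambda>\<omega>. f' (W \<omega>)) - expectation (\<lambda>\<omega>. f' (V i \<omega>))\<bar>
      \<le> expectation (\<lambda>\<omega>. (Y i \<omega>)\<^sup>2) * (8 * expectation (\<lambda>\<omega>. \<bar>Y i \<omega>\<bar>))"
      by (intro mult_left_mono) auto
    also have "\<dots> \<le> 8 * expectation (\<lambda>\<omega>. \<bar>Y i \<omega>\<bar> ^ 3)"
      using expectation_square_mult_abs_le[OF Ym[OF i] int3[OF i]] by simp
    finally have "\<bar>expectation (\<lambda>\<omega>. (Y i \<omega>)\<^sup>2) * (expectation (\<lambda>\<omega>. f' (W \<omega>)) - expectation (\<lambda>\<omega>. f' (V i \<omega>)))\<bar>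
      \<le> 8 * expectation (\<lambda>\<omega>. \<bar>Y i \<omega>\<bar> ^ 3)"
      by (simp add: abs_mult)
    with a1 show ?thesis unfolding right_diff_distrib by linarith
  qed
  have "expectation (\<lambda>\<omega>. h (W \<omega>)) - (LINT s|lborel. gauss s * h s) = expectation (\<lambda>\<omega>. f' (W \<omega>) - W \<omega> * f (W \<omega>))"
  proof -
    have hW: "(\<lambda>\<omega>. h (W \<omega>)) = (\<lambda>\<omega>. (f' (W \<omega>) - W \<omega> * f (W \<omega>)) + (LINT s|lborel. gauss s * h s))"
      using eq by (simp add: fun_eq_iff)
    show ?thesis
      unfolding hW using f'int[OF Wi] fint[OF Wi Wm] by (simp add: prob_space)
  qed
  also have "\<dots> = expectation (\<lambda>\<omega>. f' (W \<omega>)) - expectation (\<lambda>\<omega>. \<Sum>i\<in>I. Y i \<omega> * f (W \<omega>))"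
    using f'int[OF Wi] fint[OF Wi Wm] by (simp add: W_def sum_distrib_right)
  \<comment> \<open>The total variance is 1, which allows \<open>E f'(W)\<close> to be distributed
    over the summands.\<close>
  also have "\<dots> = (\<Sum>i\<in>I. expectation (\<lambda>\<omega>. (Y i \<omega>)\<^sup>2)) * expectation (\<lambda>\<omega>. f' (W \<omega>)) - (\<Sum>i\<in>I. expectation (\<lambda>\<omega>. Y i \<omega> * f (W \<omega>)))"
    using fint[OF i1 Wm] by (simp add: var)
  also have "\<dots> = (\<Sum>i\<in>I. expectation (\<lambda>\<omega>. (Y i \<omega>)\<^sup>2) * expectation (\<lambda>\<omega>. f' (W \<omega>)) - expectation (\<lambda>\<omega>. Y i \<omega> * f (W \<omega>)))"
    by (simp add: sum_subtractf sum_distrib_right)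
  finally have "\<bar>expectation (\<lambda>\<omega>. h (W \<omega>)) - (LINT s|lborel. gauss s * h s)\<bar>
     \<le> (\<Sum>i\<in>I. 16 * expectation (\<lambda>\<omega>. \<bar>Y i \<omega>\<bar> ^ 3))"
    using term_bound by (auto intro!: order_trans[OF sum_abs] sum_mono)
  then show ?thesis by (simp add: W_def sum_distrib_left)
qed

end

section \<open>Moments of the number of visits of a simple random walk\<close>

text \<open>The first \<open>n\<close> steps are uniform on this finite set, so moments become
  finite averages and their recursions plain algebra; \<open>expectation_increments\<close> leads
  back to the walk.\<close>

definition step_lists :: "nat \<Rightarrow> int list set" where
  "step_lists n = {l. set l \<subseteq> {-1, 1} \<and> length l = n}"

definition steps_mean :: "nat \<Rightarrow> (int list \<Rightarrow> real) \<Rightarrow> real" where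
  "steps_mean n g = (\<Sum>l\<in>step_lists n. g l) / 2 ^ n"

definition neighbour_mean :: "(int \<Rightarrow> real) \<Rightarrow> int \<Rightarrow> real" where
  "neighbour_mean g y = (g (y - 1) + g (y + 1)) / 2"

text \<open>Membership is tested only after a step, so time 0 is not counted, in accordance with
  times \<open>1..N\<close>.\<close>

fun visits :: "int set \<Rightarrow> int \<Rightarrow> int list \<Rightarrow> real" where
  "visits A y [] = 0"
| "visits A y (d # l) = of_bool (y + d \<in> A) + visits A (y + d) l"

lemma finite_step_lists [simp]: "finite (step_lists n)"
  unfolding step_lists_def by (rule finite_lists_length_eq) simp

lemma step_lists_0 [simp]: "step_lists 0 = {[]}"
  by (auto simp: step_lists_def)

lemma step_lists_Suc: "step_lists (Suc n) = (#) (-1) ` step_lists n \<union> (#) 1 ` step_lists n"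
  by (auto simp: step_lists_def length_Suc_conv image_iff)

lemma steps_mean_0 [simp]: "steps_mean 0 g = g []"
  by (simp add: steps_mean_def)

lemma steps_mean_Suc:
  "steps_mean (Suc n) g = (steps_mean n (\<lambda>l. g (-1 # l)) + steps_mean n (\<lambda>l. g (1 # l))) / 2"
proof -
  have "(\<Sum>l\<in>step_lists (Suc n). g l) = (\<Sum>l\<in>step_lists n. g (-1 # l)) + (\<Sum>l\<in>step_lists n. g (1 # l))"
    unfolding step_lists_Suc by (subst sum.union_disjoint) (auto simp: sum.reindex)
  then show ?thesis by (simp add: steps_mean_def field_simps)
qed

lemma card_step_lists: "card (step_lists n) = 2 ^ n"
  unfolding step_lists_def by (subst card_lists_length_eq) (auto simp: numeral_2_eq_2)

lemma steps_mean_const [simp]: "steps_mean n (\<lambda>_. c) = c"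
  by (simp add: steps_mean_def card_step_lists)

lemma steps_mean_add: "steps_mean n (\<lambda>l. f l + g l) = steps_mean n f + steps_mean n g"
  by (simp add: steps_mean_def sum.distrib add_divide_distrib)

lemma steps_mean_cmult: "steps_mean n (\<lambda>l. c * g l) = c * steps_mean n g"
  by (simp add: steps_mean_def sum_distrib_left)

lemma visits_nonneg: "visits A y l \<ge> 0"
  by (induction l arbitrary: y) auto

lemma visits_outside:
  assumes "A \<subseteq> {-R..R}" "\<bar>y\<bar> > R + int (length l)" "set l \<subseteq> {-1, 1}"
  shows "visits A y l = 0"
  using assms(2,3)
proof (induction l arbitrary: y)
  case (Cons d l)
  have d: "\<bar>d\<bar> = 1" using Cons.prems by auto
  then have "\<bar>y + d\<bar> > R + int (length l)" using Cons.prems by (simp add: abs_if split: if_splits)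
  moreover from this have "y + d \<notin> A" using assms(1) by (auto simp: abs_if subset_iff split: if_splits)
  ultimately show ?case using Cons by auto
qed simp

lemma neighbour_mean_mono: "(\<And>z. f z \<le> g z) \<Longrightarrow> neighbour_mean f y \<le> neighbour_mean g y"
  unfolding neighbour_mean_def by (intro divide_right_mono add_mono) auto

context
  fixes A :: "int set"
begin

definition visits_moment :: "nat \<Rightarrow> nat \<Rightarrow> int \<Rightarrow> real" where
  "visits_moment k n y = steps_mean n (\<lambda>l. visits A y l ^ k)"

lemma visits_moment_nonneg: "visits_moment k n y \<ge> 0"
  unfolding visits_moment_def steps_mean_def
  by (intro divide_nonneg_nonneg sum_nonneg zero_le_power visits_nonneg) auto

lemma visits_moment_0 [simp]: "k > 0 \<Longrightarrow> visits_moment k 0 y = 0"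
  by (simp add: visits_moment_def)

lemma visits_moment_Suc:
  "visits_moment k (Suc n) y =
    neighbour_mean (\<lambda>z. steps_mean n (\<lambda>l. (of_bool (z \<in> A) + visits A z l) ^ k)) y"
  by (simp add: visits_moment_def neighbour_mean_def steps_mean_Suc)

lemma visits_moment1_Suc:
  "visits_moment 1 (Suc n) y = neighbour_mean (\<lambda>z. of_bool (z \<in> A) + visits_moment 1 n z) y"
  unfolding visits_moment_Suc power_one_right by (simp add: visits_moment_def steps_mean_add)

text \<open>The indicator is idempotent, so the power splits into the moment itself and a source
  term carried by \<open>A\<close> that contains lower moments only. Summed over all starting sites,
  the source is all that is added per step.\<close>

lemma visits_moment2_Suc:
  "visits_moment 2 (Suc n) y =
    neighbour_mean (\<lambda>z. of_bool (z \<in> A) * (1 + 2 * visits_moment 1 n z) + visits_moment 2 n z) y"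
proof -
  have e: "(of_bool p + v)\<^sup>2 = of_bool p * 1 + (2 * of_bool p) * v + v\<^sup>2" for p and v :: real
    by (cases p) (auto simp: power2_eq_square algebra_simps)
  show ?thesis unfolding visits_moment_Suc e steps_mean_add steps_mean_cmult
    by (simp add: visits_moment_def algebra_simps)
qed

lemma visits_moment3_Suc:
  "visits_moment 3 (Suc n) y = neighbour_mean (\<lambda>z. of_bool (z \<in> A) *
     (1 + 3 * visits_moment 1 n z + 3 * visits_moment 2 n z) + visits_moment 3 n z) y"
proof -
  have e: "(of_bool p + v) ^ 3 = of_bool p * 1 + (3 * of_bool p) * v + (3 * of_bool p) * v\<^sup>2 + v ^ 3" for p and v :: real
    by (cases p) (auto simp: power2_eq_square power3_eq_cube algebra_simps)
  show ?thesis unfolding visits_moment_Suc e steps_mean_add steps_mean_cmult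
    by (simp add: visits_moment_def algebra_simps)
qed

section \<open>Comparison with solutions of the discrete heat equation\<close>

lemma neighbour_mean_abs:
  "neighbour_mean (\<lambda>z. real_of_int \<bar>z - x\<bar>) y = real_of_int \<bar>y - x\<bar> + of_bool (y = x)"
  unfolding neighbour_mean_def by (auto simp: abs_if)

text \<open>The mean of two roots is at most the root of the mean of their squares, and one step
  adds variance 1.\<close>

lemma neighbour_mean_sqrt_le:
  assumes "c \<ge> 0"
  shows "neighbour_mean (\<lambda>z. sqrt ((real_of_int (z - x))\<^sup>2 + c)) y \<le> sqrt ((real_of_int (y - x))\<^sup>2 + (c + 1))"
proof -
  define t where "t = real_of_int (y - x)"
  define p q where "p = sqrt ((t - 1)\<^sup>2 + c)" and "q = sqrt ((t + 1)\<^sup>2 + c)"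
  have pq: "p\<^sup>2 = (t - 1)\<^sup>2 + c" "q\<^sup>2 = (t + 1)\<^sup>2 + c"
    using assms by (simp_all add: p_def q_def)
  have "((p + q) / 2)\<^sup>2 \<le> (p\<^sup>2 + q\<^sup>2) / 2"
    using sum_squares_bound[of p q] by (simp add: power_divide power2_sum)
  also have "\<dots> = t\<^sup>2 + (c + 1)"
    unfolding pq by (simp add: power2_sum power2_diff)
  finally have "((sqrt ((t - 1)\<^sup>2 + c) + sqrt ((t + 1)\<^sup>2 + c)) / 2)\<^sup>2 \<le> t\<^sup>2 + (c + 1)"
    by (simp only: p_def q_def)
  then have "(sqrt ((t - 1)\<^sup>2 + c) + sqrt ((t + 1)\<^sup>2 + c)) / 2 \<le> sqrt (t\<^sup>2 + (c + 1))"
    by (rule real_le_rsqrt)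
  then show ?thesis unfolding neighbour_mean_def t_def by (simp add: algebra_simps)
qed

text \<open>The distance to \<open>x\<close> is harmonic except for a unit source at
  \<open>x\<close>. Subtracting it, and the indicator for the uncounted time 0, from a function that
  dominates its neighbour means one time unit earlier gives a supersolution of the first-step
  recursion; hence \<open>n + 1\<close> under the root.\<close>

lemma visits_mean_le_potential:
  assumes "finite A"
  shows "visits_moment 1 n y \<le>
    (\<Sum>x\<in>A. sqrt ((real_of_int (y - x))\<^sup>2 + (real n + 1)) - real_of_int \<bar>y - x\<bar> - of_bool (y = x))"
proof (induction n arbitrary: y)
  case 0
  have "real_of_int \<bar>y - x\<bar> + of_bool (y = x) \<le> sqrt ((real_of_int (y - x))\<^sup>2 + 1)" for x
    by (cases "y = x") (auto intro!: real_le_rsqrt)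
  then show ?case by (auto intro!: sum_nonneg simp: algebra_simps)
next
  case (Suc n)
  have ind: "of_bool (z \<in> A) = (\<Sum>x\<in>A. of_bool (z = x) :: real)" for z
    using assms by (simp add: of_bool_def sum.delta)
  have "visits_moment 1 (Suc n) y \<le> neighbour_mean (\<lambda>z. of_bool (z \<in> A) +
     (\<Sum>x\<in>A. sqrt ((real_of_int (z - x))\<^sup>2 + (real n + 1)) - real_of_int \<bar>z - x\<bar> - of_bool (z = x))) y"
    unfolding visits_moment1_Suc by (intro neighbour_mean_mono add_left_mono Suc.IH)
  also have "\<dots> = (\<Sum>x\<in>A. neighbour_mean (\<lambda>z. sqrt ((real_of_int (z - x))\<^sup>2 + (real n + 1))) y
       - neighbour_mean (\<lambda>z. real_of_int \<bar>z - x\<bar>) y)"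
    unfolding ind neighbour_mean_def
    by (simp add: sum.distrib sum_subtractf sum_divide_distrib[symmetric] diff_divide_distrib add_divide_distrib)
  also have "\<dots> \<le> (\<Sum>x\<in>A. sqrt ((real_of_int (y - x))\<^sup>2 + (real n + 1 + 1))
       - (real_of_int \<bar>y - x\<bar> + of_bool (y = x)))"
    unfolding neighbour_mean_abs by (intro sum_mono diff_right_mono neighbour_mean_sqrt_le) auto
  finally show ?case by (simp add: algebra_simps)
qed

lemma visits_mean_le:
  assumes "finite A"
  shows "visits_moment 1 n y \<le> card A * sqrt (real n + 1)"
proof -
  have "sqrt ((real_of_int (y - x))\<^sup>2 + (real n + 1)) - real_of_int \<bar>y - x\<bar> - of_bool (y = x) \<le> sqrt (real n + 1)" for x
    using sqrt_add_le_add_sqrt[of "(real_of_int (y - x))\<^sup>2" "real n + 1"] by simp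
  then have "(\<Sum>x\<in>A. sqrt ((real_of_int (y - x))\<^sup>2 + (real n + 1)) - real_of_int \<bar>y - x\<bar> - of_bool (y = x))
      \<le> (\<Sum>x\<in>A. sqrt (real n + 1))"
    by (intro sum_mono)
  with visits_mean_le_potential[OF assms, of n y] show ?thesis by simp
qed

text \<open>
  \<open>quartic s m\<close> is the \<open>m\<close>-th iterate under \<^const>\<open>neighbour_mean\<close> of
  \<open>(3 t\<^sup>2 / s - t ^ 4 / s ^ 3) / 2\<close>, which touches \<open>\<bar>t\<bar>\<close> from below at \<open>\<bar>t\<bar> = s\<close>.
\<close>

definition quartic :: "real \<Rightarrow> nat \<Rightarrow> real \<Rightarrow> real" where
  "quartic s m t = (3 * (t\<^sup>2 + m) / s - (t ^ 4 + 6 * m * t\<^sup>2 + 3 * (real m)\<^sup>2 - 2 * m) / s ^ 3) / 2"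

text \<open>With \<open>r = |t| / s\<close> the difference is
  \<open>s * r * (r - 1)^2 * (r + 2) / 2\<close>; its double zero at \<open>r = 1\<close> is the
  tangency.\<close>

lemma quartic_0_le_abs:
  assumes "s > 0" shows "quartic s 0 t \<le> \<bar>t\<bar>"
proof -
  define r where "r = \<bar>t\<bar> / s"
  have t: "\<bar>t\<bar> = r * s" "r \<ge> 0" using assms by (auto simp: r_def)
  have "t\<^sup>2 = (r * s)\<^sup>2" "t ^ 4 = (r * s) ^ 4"
    using t(1) by (metis power2_abs, metis power_even_abs even_numeral)
  then have "\<bar>t\<bar> - quartic s 0 t = s * (r * (r - 1)\<^sup>2 * (r + 2)) / 2"
    unfolding quartic_def t(1) using assms
    by (simp add: field_simps power2_eq_square power3_eq_cube power4_eq_xxxx)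
  moreover have "\<dots> \<ge> 0" using t(2) assms by simp
  ultimately show ?thesis by simp
qed

text \<open>The coefficients are the second and fourth moments of a walk after \<open>m\<close>
  steps from \<open>t\<close>: \<open>t^2 + m\<close> and
  \<open>t^4 + 6 * m * t^2 + 3 * m^2 - 2 * m\<close>. One further step replaces \<open>m\<close> by
  \<open>m + 1\<close>.\<close>

lemma neighbour_mean_quartic:
  "neighbour_mean (\<lambda>z. quartic s m (real_of_int (z - x))) y = quartic s (Suc m) (real_of_int (y - x))"
proof -
  define t where "t = real_of_int (y - x)"
  have "(quartic s m (t - 1) + quartic s m (t + 1)) / 2 = quartic s (Suc m) t"
    unfolding quartic_def by (cases "s = 0")
      (auto simp: field_simps power2_eq_square power3_eq_cube power4_eq_xxxx)
  then show ?thesis by (simp add: neighbour_mean_def t_def algebra_simps)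
qed

text \<open>Subsolution counterpart of \<open>visits_mean_le_potential\<close>. For a lower bound
  the visits to a single point of \<open>A\<close> are enough.\<close>

lemma visits_mean_ge_quartic:
  assumes "x \<in> A" "s > 0"
  shows "quartic s (Suc n) (real_of_int (y - x)) - real_of_int \<bar>y - x\<bar> - of_bool (y = x) \<le> visits_moment 1 n y"
proof (induction n arbitrary: y)
  case 0
  have "quartic s (Suc 0) (real_of_int (y - x)) \<le> neighbour_mean (\<lambda>z. \<bar>real_of_int (z - x)\<bar>) y"
    unfolding neighbour_mean_quartic[symmetric] by (intro neighbour_mean_mono quartic_0_le_abs assms)
  then show ?case using neighbour_mean_abs[of x y] by simp
next
  case (Suc n)
  have "quartic s (Suc (Suc n)) (real_of_int (y - x)) - real_of_int \<bar>y - x\<bar> - of_bool (y = x)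
     = neighbour_mean (\<lambda>z. of_bool (z = x) + (quartic s (Suc n) (real_of_int (z - x)) - real_of_int \<bar>z - x\<bar> - of_bool (z = x))) y"
    using neighbour_mean_abs[of x y] neighbour_mean_quartic[of s "Suc n" x y]
    by (simp add: neighbour_mean_def)
  also have "\<dots> \<le> visits_moment 1 (Suc n) y"
    unfolding visits_moment1_Suc using assms(1)
    by (intro neighbour_mean_mono add_mono Suc.IH) auto
  finally show ?case .
qed

lemma visits_mean_ge:
  assumes "x \<in> A"
  shows "sqrt (real n + 1) / 2 \<le> 1 + visits_moment 1 n x"
proof -
  define m where "m = sqrt (real n + 1)"
  have m: "m > 0" "m\<^sup>2 = real (Suc n)" by (auto simp: m_def)
  have "0 \<le> 1 / (8 * m)" using m by simp
  \<comment> \<open>The touching point is put at \<open>s = 2 * m\<close>, twice the standard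
    deviation of \<open>n + 1\<close> steps. The quartic at 0 is then
    \<open>9 * m / 16 + 1 / (8 * m)\<close>, which exceeds \<open>m / 2\<close>.\<close>
  then have "m / 2 \<le> 9 * m / 16 + 1 / (8 * m)" using m(1) by linarith
  also have "\<dots> = quartic (2 * m) (Suc n) 0"
    unfolding quartic_def m(2)[symmetric] using m(1)
    by (simp add: field_simps power2_eq_square power3_eq_cube)
  also have "\<dots> \<le> 1 + visits_moment 1 n x"
    using visits_mean_ge_quartic[OF assms, of "2 * m" n x] m by simp
  finally show ?thesis by (simp add: m_def)
qed

text \<open>If the means are at most \<open>B\<close>, the source of the second-moment recursion is
  at most \<open>1 + 2 * B\<close> times that of the mean, and the recursion is linear in its
  source.\<close>

lemma visits_moment2_le:
  assumes "\<And>j z. j < n \<Longrightarrow> visits_moment 1 j z \<le> B"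
  shows "visits_moment 2 n y \<le> (1 + 2 * B) * visits_moment 1 n y"
  using assms
proof (induction n arbitrary: y)
  case (Suc n)
  have "visits_moment 2 (Suc n) y \<le>
     neighbour_mean (\<lambda>z. (1 + 2 * B) * (of_bool (z \<in> A) + visits_moment 1 n z)) y"
    unfolding visits_moment2_Suc
  proof (rule neighbour_mean_mono)
    fix z
    have "of_bool (z \<in> A) * (1 + 2 * visits_moment 1 n z) \<le> of_bool (z \<in> A) * (1 + 2 * B)"
      using Suc.prems[of n z] by (intro mult_left_mono) auto
    moreover have "visits_moment 2 n z \<le> (1 + 2 * B) * visits_moment 1 n z"
      by (rule Suc.IH) (use Suc.prems in auto)
    ultimately show "of_bool (z \<in> A) * (1 + 2 * visits_moment 1 n z) + visits_moment 2 n z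
      \<le> (1 + 2 * B) * (of_bool (z \<in> A) + visits_moment 1 n z)"
      by (simp add: algebra_simps)
  qed
  also have "\<dots> = (1 + 2 * B) * visits_moment 1 (Suc n) y"
    unfolding visits_moment1_Suc neighbour_mean_def by (simp add: algebra_simps)
  finally show ?case .
qed simp

end

text \<open>Counting measure is invariant under a step. The function must vanish already at distance
  exactly \<open>K\<close>, so that a shift of the window by one site loses and gains
  nothing.\<close>

lemma sum_neighbour_mean:
  assumes "\<And>z. \<bar>z\<bar> \<ge> K \<Longrightarrow> g z = 0"
  shows "(\<Sum>y = -K..K. neighbour_mean g y) = (\<Sum>y = -K..K. g y)"
proof -
  have s: "(\<Sum>y = -K..K. g (y + d)) = (\<Sum>y = -K..K. g y)" if "\<bar>d\<bar> \<le> 1" for d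
  proof -
    have "(\<Sum>y = -K..K. g (y + d)) = (\<Sum>y = -K+d..K+d. g y)"
      by (rule sum.reindex_bij_witness[where i="\<lambda>y. y - d" and j="\<lambda>y. y + d"]) auto
    also have "\<dots> = (\<Sum>y = -K..K. g y)"
      using that by (intro sum.mono_neutral_cong) (auto intro!: assms)
    finally show ?thesis .
  qed
  show ?thesis using s[of 1] s[of "-1"]
    by (simp add: neighbour_mean_def sum_divide_distrib[symmetric] sum.distrib)
qed

section \<open>Moments summed over all starting sites\<close>

context
  fixes A :: "int set" and R K :: int and N :: nat
  assumes A: "A \<subseteq> {-R..R}" "A \<noteq> {}" and K: "K \<ge> R + int N + 1"
begin

lemma finite_target: "finite A"
  using A by (auto intro: finite_subset)

lemma R_nonneg: "R \<ge> 0"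
  using A by auto

lemma card_target_ge_1: "real (card A) \<ge> 1"
  using A finite_target by (simp add: Suc_leI card_gt_0_iff)

lemma visits_moment_outside: "k > 0 \<Longrightarrow> n < N \<Longrightarrow> \<bar>y\<bar> \<ge> K \<Longrightarrow> visits_moment A k n y = 0"
  unfolding visits_moment_def steps_mean_def using K
  by (auto intro!: sum.neutral visits_outside[OF A(1)] simp: step_lists_def)

lemma sum_of_bool_mem: "(\<Sum>y = -K..K. of_bool (y \<in> A) * g y) = (\<Sum>z\<in>A. g z :: real)"
proof -
  have "A \<subseteq> {-K..K}" using A(1) K R_nonneg by auto
  then show ?thesis
    by (intro sum.mono_neutral_cong_right) auto
qed

lemma not_mem_outside: "\<bar>z\<bar> \<ge> K \<Longrightarrow> z \<notin> A"
  using A(1) K R_nonneg by (auto simp: abs_if subset_iff split: if_splits)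

lemma total_visits_1: "n \<le> N \<Longrightarrow> (\<Sum>y = -K..K. visits_moment A 1 n y) = real n * card A"
proof (induction n)
  case (Suc n)
  have "(\<Sum>y = -K..K. visits_moment A 1 (Suc n) y) = (\<Sum>y = -K..K. of_bool (y \<in> A) * 1 + visits_moment A 1 n y)"
    unfolding visits_moment1_Suc using Suc.prems
    by (subst sum_neighbour_mean) (auto simp: not_mem_outside visits_moment_outside[of 1, simplified])
  also have "\<dots> = card A + real n * card A"
    unfolding sum.distrib sum_of_bool_mem using Suc by simp
  finally show ?case by (simp add: algebra_simps)
qed simp

text \<open>By invariance of counting measure each step adds just the sum of the source over
  \<open>A\<close>. So \<open>z\<close> is the site of a visit and \<open>j\<close> the number of
  steps left after it.\<close>

lemma total_visits_2: "n \<le> N \<Longrightarrow>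
  (\<Sum>y = -K..K. visits_moment A 2 n y) = (\<Sum>j<n. \<Sum>z\<in>A. 1 + 2 * visits_moment A 1 j z)"
proof (induction n)
  case (Suc n)
  have "(\<Sum>y = -K..K. visits_moment A 2 (Suc n) y)
    = (\<Sum>y = -K..K. of_bool (y \<in> A) * (1 + 2 * visits_moment A 1 n y) + visits_moment A 2 n y)"
    unfolding visits_moment2_Suc using Suc.prems
    by (subst sum_neighbour_mean) (auto simp: not_mem_outside visits_moment_outside)
  also have "\<dots> = (\<Sum>z\<in>A. 1 + 2 * visits_moment A 1 n z) + (\<Sum>j<n. \<Sum>z\<in>A. 1 + 2 * visits_moment A 1 j z)"
    unfolding sum.distrib[of _ _ "{-K..K}"] sum_of_bool_mem using Suc by simp
  finally show ?case by simp
qed simp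

lemma total_visits_3: "n \<le> N \<Longrightarrow> (\<Sum>y = -K..K. visits_moment A 3 n y)
   = (\<Sum>j<n. \<Sum>z\<in>A. 1 + 3 * visits_moment A 1 j z + 3 * visits_moment A 2 j z)"
proof (induction n)
  case (Suc n)
  have "(\<Sum>y = -K..K. visits_moment A 3 (Suc n) y)
    = (\<Sum>y = -K..K. of_bool (y \<in> A) * (1 + 3 * visits_moment A 1 n y + 3 * visits_moment A 2 n y) + visits_moment A 3 n y)"
    unfolding visits_moment3_Suc using Suc.prems
    by (subst sum_neighbour_mean) (auto simp: not_mem_outside visits_moment_outside)
  also have "\<dots> = (\<Sum>z\<in>A. 1 + 3 * visits_moment A 1 n z + 3 * visits_moment A 2 n z)
      + (\<Sum>j<n. \<Sum>z\<in>A. 1 + 3 * visits_moment A 1 j z + 3 * visits_moment A 2 j z)"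
    unfolding sum.distrib[of _ _ "{-K..K}"] sum_of_bool_mem using Suc by simp
  finally show ?case by simp
qed simp

lemma visits_mean_le_uniform: "j < N \<Longrightarrow> visits_moment A 1 j z \<le> card A * sqrt N"
  by (rule order_trans[OF visits_mean_le[OF finite_target]]) (auto intro!: mult_left_mono)

lemma sqrt_N_bounds: "N \<ge> 1 \<Longrightarrow> 1 \<le> card A * sqrt N"
  using mult_mono[OF card_target_ge_1, of 1 "sqrt N"] by simp

text \<open>One point \<open>x\<close> of \<open>A\<close> is kept. The 1 in the source makes up for
  the 1 that \<open>visits_mean_ge\<close> has beside the mean.\<close>

lemma total_visits_2_ge:
  assumes "N \<ge> 1"
  shows "real N * sqrt N / 4 \<le> (\<Sum>y = -K..K. visits_moment A 2 N y)"
proof -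
  obtain x where x: "x \<in> A" using A by auto
  have "real N * sqrt N / 4 = real N * real N / (4 * sqrt N)"
    using assms by (simp add: field_simps)
  also have "\<dots> \<le> (\<Sum>j<N. real (Suc j)) / (2 * sqrt N)"
  proof -
    have "real (\<Sum>j<N. Suc j) \<ge> real N * real N / 2"
    proof (induction N)
      case (Suc n) then show ?case by (simp add: algebra_simps)
    qed simp
    then have "(\<Sum>j<N. real (Suc j)) \<ge> real N * real N / 2" by simp
    then have "(real N * real N / 2) / (2 * sqrt N) \<le> (\<Sum>j<N. real (Suc j)) / (2 * sqrt N)"
      by (intro divide_right_mono) auto
    then show ?thesis by simp
  qed
  also have "\<dots> = (\<Sum>j<N. real (Suc j) / (2 * sqrt N))" by (rule sum_divide_distrib)
  also have "\<dots> \<le> (\<Sum>j<N. \<Sum>z\<in>A. 1 + 2 * visits_moment A 1 j z)"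
  proof (rule sum_mono)
    fix j assume j: "j \<in> {..<N}"
    \<comment> \<open>For \<open>j < N\<close> the root of \<open>j + 1\<close> is at least
      \<open>(j + 1) / sqrt N\<close>, so an arithmetic series replaces the sum of roots.\<close>
    have "real (Suc j) = sqrt (real (Suc j)) * sqrt (real (Suc j))" by simp
    also have "\<dots> \<le> sqrt (real (Suc j)) * sqrt N" using j by (intro mult_left_mono) auto
    finally have "real (Suc j) / (2 * sqrt N) \<le> sqrt (real j + 1) / 2"
      using assms by (simp add: field_simps)
    also have "\<dots> \<le> 1 + 2 * visits_moment A 1 j x"
      using visits_mean_ge[OF x, of j] visits_moment_nonneg[of A 1 j x] by linarith
    also have "\<dots> \<le> (\<Sum>z\<in>A. 1 + 2 * visits_moment A 1 j z)"
      using x finite_target by (intro member_le_sum) (auto intro!: add_nonneg_nonneg visits_moment_nonneg)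
    finally show "real (Suc j) / (2 * sqrt N) \<le> (\<Sum>z\<in>A. 1 + 2 * visits_moment A 1 j z)" .
  qed
  finally show ?thesis by (simp only: total_visits_2[OF order_refl])
qed

lemma total_visits_2_le:
  assumes "N \<ge> 1"
  shows "(\<Sum>y = -K..K. visits_moment A 2 N y) \<le> 3 * real (card A) ^ 2 * (real N * sqrt N)"
proof -
  have "(\<Sum>j<N. \<Sum>z\<in>A. 1 + 2 * visits_moment A 1 j z) \<le> (\<Sum>j<N. \<Sum>z\<in>A. 3 * (card A * sqrt N))"
  proof (intro sum_mono)
    fix j z assume "j \<in> {..<N}"
    then show "1 + 2 * visits_moment A 1 j z \<le> 3 * (card A * sqrt N)"
      using visits_mean_le_uniform[of j z] sqrt_N_bounds[OF assms] by simp
  qed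
  then show ?thesis
    unfolding total_visits_2[OF order_refl] by (simp add: power2_eq_square algebra_simps)
qed

lemma total_visits_3_le:
  assumes "N \<ge> 1"
  shows "(\<Sum>y = -K..K. visits_moment A 3 N y) \<le> 13 * real (card A) ^ 3 * (real N)\<^sup>2"
proof -
  define b where "b = card A * sqrt N"
  have b: "b \<ge> 1" using sqrt_N_bounds[OF assms] by (simp add: b_def)
  have b2: "b \<le> b * b" using mult_left_mono[OF b, of b] b by simp
  \<comment> \<open>The summand is at most \<open>1 + 3 * b + 3 * (b + 2 * b^2)\<close>, and
    \<open>1 \<le> b \<le> b^2\<close> turns the coefficients 1, 3, 3 and 6 into 13.\<close>
  have "(\<Sum>j<N. \<Sum>z\<in>A. 1 + 3 * visits_moment A 1 j z + 3 * visits_moment A 2 j z) \<le> (\<Sum>j<N. \<Sum>z\<in>A. 13 * (b * b))"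
  proof (intro sum_mono)
    fix j z assume j: "j \<in> {..<N}"
    have 1: "visits_moment A 1 j z \<le> b" using j unfolding b_def by (intro visits_mean_le_uniform) auto
    have "visits_moment A 2 j z \<le> (1 + 2 * b) * visits_moment A 1 j z"
    proof (rule visits_moment2_le)
      show "visits_moment A 1 i x \<le> b" if "i < j" for i x
        using that j unfolding b_def by (intro visits_mean_le_uniform) auto
    qed
    also have "\<dots> \<le> (1 + 2 * b) * b" using b by (intro mult_left_mono 1) auto
    also have "\<dots> = b + 2 * (b * b)" by (simp add: algebra_simps)
    finally show "1 + 3 * visits_moment A 1 j z + 3 * visits_moment A 2 j z \<le> 13 * (b * b)"
      using 1 b b2 by linarith
  qed
  also have "\<dots> = 13 * real (card A) ^ 3 * (real N)\<^sup>2"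
    by (simp add: b_def power2_eq_square power3_eq_cube algebra_simps)
  finally show ?thesis by (simp only: total_visits_3[OF order_refl])
qed

text \<open>Cauchy-Schwarz runs over pairs of a starting site and a step list, with visits
  \<open>a\<close> and hit indicator \<open>b\<close>, where \<open>a * b = a\<close> and
  \<open>b^2 = b\<close>. The factors \<open>card A ^ 2\<close> cancel, which is why the bound is
  free of \<open>A\<close>.\<close>

lemma total_hits_ge:
  assumes "N \<ge> 1"
  shows "sqrt N / 3 \<le> (\<Sum>y = -K..K. steps_mean N (\<lambda>l. of_bool (visits A y l > 0)))"
proof -
  let ?S = "{-K..K} \<times> step_lists N"
  let ?a = "\<lambda>(y, l). visits A y l" and ?b = "\<lambda>(y, l). of_bool (visits A y l > 0) :: real"
  define H where "H = (\<Sum>y = -K..K. steps_mean N (\<lambda>l. of_bool (visits A y l > 0)))"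
  have tot: "(\<Sum>y = -K..K. steps_mean N (\<lambda>l. g y l)) = (\<Sum>(y, l)\<in>?S. g y l) / 2 ^ N" for g
    unfolding steps_mean_def sum_divide_distrib[symmetric] by (simp add: sum.cartesian_product)
  have ab: "(\<lambda>p. ?a p * ?b p) = ?a"
    using visits_nonneg by (auto simp: fun_eq_iff of_bool_def order_le_less)
  have bb: "(\<lambda>p. (?b p)\<^sup>2) = ?b" by (auto simp: fun_eq_iff)
  have aa: "(\<lambda>p. (?a p)\<^sup>2) = (\<lambda>(y, l). visits A y l ^ 2)" by auto
  have H0: "H \<ge> 0" unfolding H_def tot by (intro divide_nonneg_nonneg sum_nonneg) auto
  have V1: "real N * card A = (\<Sum>p\<in>?S. ?a p) / 2 ^ N"
    unfolding total_visits_1[OF order_refl, symmetric] visits_moment_def tot by simp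
  have "(real N * card A)\<^sup>2 = (\<Sum>p\<in>?S. ?a p * ?b p)\<^sup>2 / (2 ^ N)\<^sup>2"
    unfolding V1 ab by (simp add: power_divide)
  also have "\<dots> \<le> ((\<Sum>p\<in>?S. (?a p)\<^sup>2) * (\<Sum>p\<in>?S. (?b p)\<^sup>2)) / (2 ^ N)\<^sup>2"
    by (intro divide_right_mono Cauchy_Schwarz_ineq_sum) auto
  also have "\<dots> = (\<Sum>y = -K..K. visits_moment A 2 N y) * H"
    unfolding bb aa H_def tot visits_moment_def by (simp add: power2_eq_square)
  also have "\<dots> \<le> (3 * real (card A) ^ 2 * (real N * sqrt N)) * H"
    by (intro mult_right_mono total_visits_2_le assms H0)
  finally have "(real N * (real (card A))\<^sup>2 * sqrt N) * sqrt N \<le> (real N * (real (card A))\<^sup>2 * sqrt N) * (3 * H)"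
    by (simp add: power2_eq_square algebra_simps)
  then have "sqrt N \<le> 3 * H"
    using assms card_target_ge_1 by (subst (asm) mult_le_cancel_left_pos) auto
  then show ?thesis by (simp add: H_def)
qed

end

section \<open>Increments of the simple symmetric random walk\<close>

definition increments :: "nat \<Rightarrow> (nat \<Rightarrow> int) \<Rightarrow> int list" where
  "increments N p = map (\<lambda>k. p (Suc k) - p k) [0..<N]"

lemma increments_Suc: "increments (Suc N) p = increments N p @ [p (Suc N) - p N]"
  by (simp add: increments_def)

lemma sum_list_increments: "p 0 + sum_list (increments N p) = p N"
  by (induction N) (simp_all add: increments_def)

text \<open>\<open>visits\<close> recurses from the first step, whereas a time horizon grows by a
  last step; this reconciles the two.\<close>

lemma visits_append: "visits A y (l @ [d]) = visits A y l + of_bool (y + sum_list l + d \<in> A)"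
  by (induction l arbitrary: y) (simp_all add: add.assoc)

lemma visits_increments:
  "p 0 = y \<Longrightarrow> visits A y (increments N p) = (\<Sum>n = 1..N. of_bool (p n \<in> A))"
proof (induction N)
  case (Suc N)
  have "y + sum_list (increments N p) + (p (Suc N) - p N) = p (Suc N)"
    using sum_list_increments[of p N] Suc.prems by simp
  then show ?case using Suc by (simp only: increments_Suc visits_append) simp
qed (simp add: increments_def)

lemma visits_increments_pos_iff:
  assumes "p 0 = y"
  shows "visits A y (increments N p) > 0 \<longleftrightarrow> (\<exists>m\<in>{1..N}. p m \<in> A)"
proof -
  have "visits A y (increments N p) \<noteq> 0 \<longleftrightarrow> (\<exists>m\<in>{1..N}. p m \<in> A)"
    unfolding visits_increments[where p=p and y=y, OF assms] by (subst sum_nonneg_eq_0_iff) auto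
  then show ?thesis using visits_nonneg[of A y "increments N p"] by linarith
qed

context prob_space begin

context
  fixes y :: int and S :: "nat \<Rightarrow> 'a \<Rightarrow> int"
  assumes rw: "simple_symmetric_rw y S"
begin

lemma random_variable_increment [measurable]:
  "random_variable (count_space UNIV) (\<lambda>\<omega>. S (Suc n) \<omega> - S n \<omega>)"
  using rw by (simp add: simple_symmetric_rw_def indep_vars_def)

lemma simple_symmetric_rw_start: "\<omega> \<in> space M \<Longrightarrow> S 0 \<omega> = y"
  using rw by (simp add: simple_symmetric_rw_def)

lemma random_variable_simple_symmetric_rw: "random_variable (count_space UNIV) (S n)"
proof (induction n)
  case 0
  show ?case
    by (subst measurable_cong[where g="\<lambda>_. y"]) (auto simp: simple_symmetric_rw_start)
next
  case (Suc n)
  note [measurable] = this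
  have "random_variable (count_space UNIV) (\<lambda>\<omega>. S n \<omega> + (S (Suc n) \<omega> - S n \<omega>))"
    by measurable
  then show ?case by simp
qed

lemma prob_increment:
  assumes "d \<in> {-1, 1}"
  shows "prob ((\<lambda>\<omega>. S (Suc n) \<omega> - S n \<omega>) -` {d} \<inter> space M) = 1 / 2"
proof -
  have "distr M (count_space UNIV) (\<lambda>\<omega>. S (Suc n) \<omega> - S n \<omega>) = measure_pmf (pmf_of_set {-1, 1})"
    using rw by (simp add: simple_symmetric_rw_def)
  then have "measure (measure_pmf (pmf_of_set {-1, 1})) {d} = prob ((\<lambda>\<omega>. S (Suc n) \<omega> - S n \<omega>) -` {d} \<inter> space M)"
    using measure_distr[OF random_variable_increment, of "{d}" n] by simp
  then show ?thesis using assms by (auto simp: measure_pmf_single)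
qed

lemma AE_increment: "AE \<omega> in M. S (Suc n) \<omega> - S n \<omega> \<in> {-1, 1}"
proof -
  have "distr M (count_space UNIV) (\<lambda>\<omega>. S (Suc n) \<omega> - S n \<omega>) = measure_pmf (pmf_of_set {-1, 1})"
    using rw by (simp add: simple_symmetric_rw_def)
  then have "AE d in distr M (count_space UNIV) (\<lambda>\<omega>. S (Suc n) \<omega> - S n \<omega>). d \<in> {-1, 1}"
    by (simp only: AE_measure_pmf_iff) simp
  then show ?thesis by (subst (asm) AE_distr_iff) auto
qed

lemma AE_simple_symmetric_rw_dist: "AE \<omega> in M. \<forall>n. \<bar>S n \<omega> - y\<bar> \<le> int n"
proof -
  have "AE \<omega> in M. \<forall>n. S (Suc n) \<omega> - S n \<omega> \<in> {-1, 1}"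
    unfolding AE_all_countable using AE_increment by blast
  moreover have "AE \<omega> in M. \<omega> \<in> space M" by (rule AE_space)
  ultimately show ?thesis
  proof eventually_elim
    case (elim \<omega>)
    show ?case
    proof
      fix n show "\<bar>S n \<omega> - y\<bar> \<le> int n"
      proof (induction n)
        case (Suc n)
        have "S (Suc n) \<omega> - S n \<omega> = -1 \<or> S (Suc n) \<omega> - S n \<omega> = 1" using elim by auto
        with Suc show ?case by linarith
      qed (simp add: simple_symmetric_rw_start elim)
    qed
  qed
qed

text \<open>The leading \<open>space M\<close> is for \<open>N = 0\<close>, where the intersection
  over no indices is the whole type.\<close>

lemma increments_event:
  "(\<lambda>\<omega>. increments N (\<lambda>n. S n \<omega>)) -` {l} \<inter> space M =
    (if length l = N then space M \<inter> (\<Inter>k<N. (\<lambda>\<omega>. S (Suc k) \<omega> - S k \<omega>) -` {l ! k} \<inter> space M) else {})"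
proof -
  have "increments N p = l \<longleftrightarrow> length l = N \<and> (\<forall>k<N. p (Suc k) - p k = l ! k)" for p
    by (subst list_eq_iff_nth_eq) (auto simp: increments_def)
  then show ?thesis by auto
qed

lemma random_variable_increments [measurable]:
  "random_variable (count_space UNIV) (\<lambda>\<omega>. increments N (\<lambda>n. S n \<omega>))"
proof -
  have "(\<lambda>\<omega>. increments N (\<lambda>n. S n \<omega>)) -` {l} \<inter> space M \<in> events" for l
  proof -
    have "space M \<inter> (\<Inter>k<N. (\<lambda>\<omega>. S (Suc k) \<omega> - S k \<omega>) -` {l ! k} \<inter> space M) \<in> events"
    proof (cases "N = 0")
      case False
      show ?thesis
      proof (rule sets.Int[OF sets.top], rule sets.finite_INT)
        show "(\<lambda>\<omega>. S (Suc k) \<omega> - S k \<omega>) -` {l ! k} \<inter> space M \<in> events" for k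
          by (rule measurable_sets[OF random_variable_increment]) simp
      qed (use False in auto)
    qed simp
    then show ?thesis unfolding increments_event by simp
  qed
  then show ?thesis by (subst measurable_count_space_eq_countable) auto
qed

lemma prob_increments:
  assumes "l \<in> step_lists N"
  shows "prob ((\<lambda>\<omega>. increments N (\<lambda>n. S n \<omega>)) -` {l} \<inter> space M) = 1 / 2 ^ N"
proof (cases "N = 0")
  case True
  then show ?thesis using assms by (simp add: increments_def prob_space)
next
  case False
  have ind: "indep_vars (\<lambda>_. count_space UNIV) (\<lambda>n \<omega>. S (Suc n) \<omega> - S n \<omega>) UNIV"
    using rw by (simp add: simple_symmetric_rw_def)
  have "prob ((\<lambda>\<omega>. increments N (\<lambda>n. S n \<omega>)) -` {l} \<inter> space M)
     = prob (\<Inter>k\<in>{..<N}. (\<lambda>\<omega>. S (Suc k) \<omega> - S k \<omega>) -` {l ! k} \<inter> space M)"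
    unfolding increments_event using assms False
    by (intro arg_cong[where f=prob]) (auto simp: step_lists_def)
  also have "\<dots> = (\<Prod>k<N. prob ((\<lambda>\<omega>. S (Suc k) \<omega> - S k \<omega>) -` {l ! k} \<inter> space M))"
    using False by (intro indep_varsD[OF ind]) auto
  also have "\<dots> = (\<Prod>k<N. 1 / 2)"
  proof (intro prod.cong refl prob_increment)
    fix k assume "k \<in> {..<N}"
    then have "l ! k \<in> set l" using assms by (simp add: step_lists_def)
    then show "l ! k \<in> {-1, 1}" using assms unfolding step_lists_def by blast
  qed
  finally show ?thesis by (simp add: power_one_over)
qed

lemma AE_increments: "AE \<omega> in M. increments N (\<lambda>n. S n \<omega>) \<in> step_lists N"
proof -
  have "AE \<omega> in M. \<forall>n. S (Suc n) \<omega> - S n \<omega> \<in> {-1, 1}"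
    unfolding AE_all_countable using AE_increment by blast
  then show ?thesis
    by eventually_elim (auto simp: step_lists_def increments_def)
qed

text \<open>The increments almost surely lie in a finite set of equally likely lists, so
  \<open>g\<close> can be arbitrary: it is almost surely a finite combination of indicators.\<close>

lemma expectation_increments:
  "expectation (\<lambda>\<omega>. g (increments N (\<lambda>n. S n \<omega>))) = steps_mean N g"
proof -
  let ?I = "\<lambda>\<omega>. increments N (\<lambda>n. S n \<omega>)"
  have ev: "?I -` {l} \<inter> space M \<in> events" for l
    by (rule measurable_sets[OF random_variable_increments]) simp
  have "expectation (\<lambda>\<omega>. g (?I \<omega>)) = expectation (\<lambda>\<omega>. \<Sum>l\<in>step_lists N. g l * indicator (?I -` {l} \<inter> space M) \<omega>)"
  proof (rule integral_cong_AE)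
    show "AE \<omega> in M. g (?I \<omega>) = (\<Sum>l\<in>step_lists N. g l * indicator (?I -` {l} \<inter> space M) \<omega>)"
      using AE_increments[of N] AE_space
    proof eventually_elim
      case (elim \<omega>)
      have "(\<Sum>l\<in>step_lists N. g l * indicator (?I -` {l} \<inter> space M) \<omega>)
        = (\<Sum>l\<in>step_lists N. if l = ?I \<omega> then g l else 0)"
        using elim by (intro sum.cong) (auto simp: indicator_def)
      then show ?case using elim by simp
    qed
  qed (use ev in \<open>auto intro!: measurable_compose[OF random_variable_increments]\<close>)
  also have "\<dots> = (\<Sum>l\<in>step_lists N. g l * prob (?I -` {l} \<inter> space M))"
    using ev by (subst Bochner_Integration.integral_sum) (auto simp: emeasure_eq_measure)
  also have "\<dots> = (\<Sum>l\<in>step_lists N. g l * (1 / 2 ^ N))"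
    by (intro sum.cong refl) (simp add: prob_increments)
  finally show ?thesis by (simp add: steps_mean_def sum_divide_distrib)
qed

end

end

section \<open>Compound Poisson sums\<close>

text \<open>Size-bias (Mecke) identity, from \<open>(n + 1) * p (n + 1) = lam * p n\<close>. In
  extended nonnegative reals it holds without any integrability condition and so also proves
  finiteness of moments.\<close>

lemma nn_integral_poisson_size_bias:
  fixes \<phi> :: "nat \<Rightarrow> ennreal"
  assumes lam: "lam > 0"
  shows "(\<integral>\<^sup>+n. of_nat n * \<phi> (n - 1) \<partial>poisson_pmf lam) = ennreal lam * (\<integral>\<^sup>+n. \<phi> n \<partial>poisson_pmf lam)"
proof -
  let ?p = "\<lambda>n. ennreal (pmf (poisson_pmf lam) n)"
  have step: "?p (Suc n) * of_nat (Suc n) = ennreal lam * ?p n" for n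
  proof -
    have "?p (Suc n) * of_nat (Suc n) = ennreal (pmf (poisson_pmf lam) (Suc n) * real (Suc n))"
      by (subst ennreal_mult) (auto simp: ennreal_of_nat_eq_real_of_nat)
    also have "pmf (poisson_pmf lam) (Suc n) * real (Suc n) = lam * pmf (poisson_pmf lam) n"
      using lam by (simp add: field_simps del: of_nat_Suc)
    also have "ennreal (lam * pmf (poisson_pmf lam) n) = ennreal lam * ?p n"
      using lam by (intro ennreal_mult) auto
    finally show ?thesis .
  qed
  have "(\<integral>\<^sup>+n. of_nat n * \<phi> (n - 1) \<partial>poisson_pmf lam) = (\<Sum>n. ?p n * (of_nat n * \<phi> (n - 1)))"
    by (simp add: nn_integral_measure_pmf nn_integral_count_space_nat)
  also have "\<dots> = (\<Sum>n. ?p (Suc n) * (of_nat (Suc n) * \<phi> n))"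
    using suminf_offset[of "\<lambda>n. ?p n * (of_nat n * \<phi> (n - 1))" 1] by (simp add: ennreal_suminf_lessD)
  also have "\<dots> = (\<Sum>n. ennreal lam * (?p n * \<phi> n))"
    using step by (simp add: mult.assoc[symmetric])
  also have "\<dots> = ennreal lam * (\<Sum>n. ?p n * \<phi> n)" by simp
  also have "(\<Sum>n. ?p n * \<phi> n) = (\<integral>\<^sup>+n. \<phi> n \<partial>poisson_pmf lam)"
    by (simp add: nn_integral_measure_pmf nn_integral_count_space_nat)
  finally show ?thesis .
qed

lemma nn_integral_poisson_1:
  "lam > 0 \<Longrightarrow> (\<integral>\<^sup>+n. of_nat n \<partial>poisson_pmf lam) = ennreal lam"
  using nn_integral_poisson_size_bias[of lam "\<lambda>_. 1"] by (simp add: measure_pmf.emeasure_space_1[simplified])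

lemma nn_integral_poisson_2:
  assumes "lam > 0"
  shows "(\<integral>\<^sup>+n. of_nat n * of_nat n \<partial>poisson_pmf lam) = ennreal (lam * (lam + 1))"
proof -
  have e: "of_nat n * of_nat n = of_nat n * (of_nat (n - 1) + (1::ennreal))" for n
    by (cases n) (simp_all add: add.commute)
  have "(\<integral>\<^sup>+n. of_nat n * of_nat n \<partial>poisson_pmf lam) = (\<integral>\<^sup>+n. of_nat n * (of_nat (n - 1) + 1) \<partial>poisson_pmf lam)"
    by (simp only: e)
  also have "\<dots> = ennreal lam * (ennreal lam + 1)"
    using assms by (subst nn_integral_poisson_size_bias)
      (auto simp: nn_integral_add nn_integral_poisson_1 measure_pmf.emeasure_space_1[simplified])
  finally show ?thesis using assms by (simp add: ennreal_mult)
qed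

text \<open>\<open>n^3 = n * ((n - 1) + 1)^2\<close>, so the size-bias identity reduces the third
  moment to the first two.\<close>

lemma nn_integral_poisson_3:
  assumes "lam > 0"
  shows "(\<integral>\<^sup>+n. of_nat n * (of_nat n * of_nat n) \<partial>poisson_pmf lam) = ennreal (lam * (lam\<^sup>2 + 3 * lam + 1))"
proof -
  have e: "of_nat n * (of_nat n * of_nat n) = of_nat n * (of_nat (n - 1) * of_nat (n - 1) + 2 * of_nat (n - 1) + (1::ennreal))" for n
  proof -
    have "n * (n * n) = n * ((n - 1) * (n - 1) + 2 * (n - 1) + 1)"
      by (cases n) (simp_all add: algebra_simps)
    from arg_cong[OF this, of "of_nat :: nat \<Rightarrow> ennreal"] show ?thesis
      by (simp only: of_nat_mult of_nat_add of_nat_numeral of_nat_1)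
  qed
  have "(\<integral>\<^sup>+n. of_nat n * (of_nat n * of_nat n) \<partial>poisson_pmf lam)
     = (\<integral>\<^sup>+n. of_nat n * (of_nat (n - 1) * of_nat (n - 1) + 2 * of_nat (n - 1) + 1) \<partial>poisson_pmf lam)"
    by (simp only: e)
  also have "\<dots> = ennreal lam * (ennreal (lam * (lam + 1)) + 2 * ennreal lam + 1)"
    by (subst nn_integral_poisson_size_bias[OF assms, where \<phi>="\<lambda>j. of_nat j * of_nat j + 2 * of_nat j + 1"])
      (simp add: nn_integral_add nn_integral_cmult nn_integral_poisson_1[OF assms] nn_integral_poisson_2[OF assms] measure_pmf.emeasure_space_1[simplified])
  also have "\<dots> = ennreal lam * ennreal (lam * (lam + 1) + 2 * lam + 1)"
    using assms by (simp add: ennreal_mult')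
  also have "\<dots> = ennreal (lam * (lam\<^sup>2 + 3 * lam + 1))"
    using assms by (subst ennreal_mult[symmetric]) (auto simp: power2_eq_square algebra_simps)
  finally show ?thesis .
qed

text \<open>Power mean inequality, from the tangent of the cube at the average \<open>t\<close> of
  the \<open>g i\<close>.\<close>

lemma sum_cubed_le:
  fixes g :: "'i \<Rightarrow> real"
  assumes "finite I" "\<And>i. i \<in> I \<Longrightarrow> g i \<ge> 0"
  shows "(\<Sum>i\<in>I. g i) ^ 3 \<le> (real (card I))\<^sup>2 * (\<Sum>i\<in>I. g i ^ 3)"
proof (cases "I = {}")
  case False
  define n where "n = real (card I)"
  define t where "t = (\<Sum>i\<in>I. g i) / n"
  have n: "n > 0" using False assms by (simp add: n_def card_gt_0_iff)
  have t: "t \<ge> 0" "(\<Sum>i\<in>I. g i) = n * t" using n assms by (auto simp: t_def sum_nonneg)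
  have "3 * t\<^sup>2 * g i - 2 * t ^ 3 \<le> g i ^ 3" if "i \<in> I" for i
  proof -
    have "0 \<le> (g i - t)\<^sup>2 * (g i + 2 * t)" using assms(2)[OF that] t by simp
    then show ?thesis by (simp add: power2_eq_square power3_eq_cube algebra_simps)
  qed
  then have "(\<Sum>i\<in>I. 3 * t\<^sup>2 * g i - 2 * t ^ 3) \<le> (\<Sum>i\<in>I. g i ^ 3)"
    by (rule sum_mono)
  also have "(\<Sum>i\<in>I. 3 * t\<^sup>2 * g i - 2 * t ^ 3) = 3 * t\<^sup>2 * (\<Sum>i\<in>I. g i) - n * (2 * t ^ 3)"
    by (simp add: sum_subtractf sum_distrib_left n_def)
  also have "\<dots> = n * t ^ 3"
    unfolding t(2) by (simp add: power2_eq_square power3_eq_cube)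
  finally have "n\<^sup>2 * (n * t ^ 3) \<le> n\<^sup>2 * (\<Sum>i\<in>I. g i ^ 3)" by (intro mult_left_mono) auto
  then show ?thesis unfolding t(2) n_def[symmetric] by (simp add: power_mult_distrib power2_eq_square power3_eq_cube algebra_simps)
qed simp

lemma abs_diff_cubed_le:
  fixes a b :: real assumes "a \<ge> 0" "b \<ge> 0" shows "\<bar>a - b\<bar> ^ 3 \<le> a ^ 3 + b ^ 3"
proof (cases "a \<le> b")
  case True
  then have "\<bar>a - b\<bar> ^ 3 \<le> b ^ 3" using assms by (intro power_mono) auto
  then show ?thesis using assms by (simp add: add_increasing)
next
  case False
  then have "\<bar>a - b\<bar> ^ 3 \<le> a ^ 3" using assms by (intro power_mono) auto
  then show ?thesis using assms by (simp add: add_increasing2)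
qed

definition partial_sum :: "(nat \<Rightarrow> 'a \<Rightarrow> real) \<Rightarrow> nat \<Rightarrow> 'a \<Rightarrow> real" where
  "partial_sum g n \<omega> = (\<Sum>i<n. g i \<omega>)"

definition random_sum :: "('a \<Rightarrow> nat) \<Rightarrow> (nat \<Rightarrow> 'a \<Rightarrow> real) \<Rightarrow> 'a \<Rightarrow> real" where
  "random_sum \<nu> g \<omega> = partial_sum g (\<nu> \<omega>) \<omega>"

section \<open>Independence of reindexed and merged families\<close>

context prob_space begin

lemma indep_vars_reindex:
  assumes "indep_vars M' X I" "inj_on t J" "t ` J \<subseteq> I"
  shows "indep_vars (\<lambda>j. M' (t j)) (\<lambda>j. X (t j)) J"
  unfolding indep_vars_def2
proof (intro conjI ballI)
  show rv: "random_variable (M' (t j)) (X (t j))" if "j \<in> J" for j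
    using assms that by (auto simp: indep_vars_def)
  show "indep_sets (\<lambda>j. {X (t j) -` A \<inter> space M |A. A \<in> sets (M' (t j))}) J"
  proof (rule indep_setsI)
    fix j assume "j \<in> J"
    then show "{X (t j) -` A \<inter> space M |A. A \<in> sets (M' (t j))} \<subseteq> events"
      using rv by (auto intro: measurable_sets)
  next
    fix F K assume K: "K \<noteq> {}" "K \<subseteq> J" "finite K"
      and F: "\<forall>j\<in>K. F j \<in> {X (t j) -` A \<inter> space M |A. A \<in> sets (M' (t j))}"
    have inj: "inj_on t K" using assms(2) K(2) by (rule inj_on_subset)
    let ?F = "\<lambda>i. F (the_inv_into K t i)"
    have "indep_sets (\<lambda>i. {X i -` A \<inter> space M |A. A \<in> sets (M' i)}) I"
      using assms(1) by (simp add: indep_vars_def2)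
    then have "prob (\<Inter>i\<in>t ` K. ?F i) = (\<Prod>i\<in>t ` K. prob (?F i))"
    proof (rule indep_setsD)
      show "\<forall>i\<in>t ` K. ?F i \<in> {X i -` A \<inter> space M |A. A \<in> sets (M' i)}"
        using F inj by (simp add: the_inv_into_f_f)
    qed (use K assms(3) in auto)
    moreover have "(\<Inter>i\<in>t ` K. ?F i) = (\<Inter>j\<in>K. F j)"
      using inj by (simp add: image_image the_inv_into_f_f)
    moreover have "(\<Prod>i\<in>t ` K. prob (?F i)) = (\<Prod>j\<in>K. prob (F j))"
      using inj by (simp add: prod.reindex the_inv_into_f_f)
    ultimately show "prob (\<Inter>j\<in>K. F j) = (\<Prod>j\<in>K. prob (F j))" by simp
  qed
qed

lemma indep_vars_sum_square:
  fixes Y :: "'i \<Rightarrow> 'a \<Rightarrow> real"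
  assumes "finite I" "indep_vars (\<lambda>_. borel) Y I"
    and "\<And>i. i \<in> I \<Longrightarrow> integrable M (Y i)" "\<And>i. i \<in> I \<Longrightarrow> integrable M (\<lambda>\<omega>. (Y i \<omega>)\<^sup>2)"
    and "\<And>i. i \<in> I \<Longrightarrow> expectation (Y i) = 0"
  shows "integrable M (\<lambda>\<omega>. (\<Sum>i\<in>I. Y i \<omega>)\<^sup>2) \<and>
    expectation (\<lambda>\<omega>. (\<Sum>i\<in>I. Y i \<omega>)\<^sup>2) = (\<Sum>i\<in>I. expectation (\<lambda>\<omega>. (Y i \<omega>)\<^sup>2))"
  using assms
proof (induction I rule: finite_induct)
  case (insert i I)
  let ?W = "\<lambda>\<omega>. \<Sum>j\<in>I. Y j \<omega>"
  have IH: "integrable M (\<lambda>\<omega>. (?W \<omega>)\<^sup>2)" "expectation (\<lambda>\<omega>. (?W \<omega>)\<^sup>2) = (\<Sum>i\<in>I. expectation (\<lambda>\<omega>. (Y i \<omega>)\<^sup>2))"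
    using insert.IH[OF indep_vars_subset[OF insert.prems(1)]] insert.prems by auto
  have ind: "indep_var borel (Y i) borel ?W"
    by (rule indep_vars_sum[OF insert.hyps(1,2) insert.prems(1)])
  have Wi: "integrable M ?W" using insert.prems by auto
  have p: "integrable M (\<lambda>\<omega>. Y i \<omega> * ?W \<omega>)" "expectation (\<lambda>\<omega>. Y i \<omega> * ?W \<omega>) = 0"
    using indep_var_integrable[OF ind _ Wi] indep_var_lebesgue_integral[OF ind _ Wi] insert.prems by auto
  have e: "(\<lambda>\<omega>. (\<Sum>j\<in>insert i I. Y j \<omega>)\<^sup>2) = (\<lambda>\<omega>. (Y i \<omega>)\<^sup>2 + 2 * (Y i \<omega> * ?W \<omega>) + (?W \<omega>)\<^sup>2)"
    using insert.hyps by (simp add: fun_eq_iff power2_sum)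
  show ?case
    unfolding e using p IH insert.prems insert.hyps by simp
qed simp

text \<open>A finite intersection splits into its parts over \<open>I\<close> and over the rest. The
  two systems need only contain these partial intersections, so the independence assumption of the
  locale can be used as it stands.\<close>

lemma indep_vars_Un:
  assumes V: "indep_vars M' V I" "indep_vars M' V J"
    and ind: "indep_set \<A> \<B>"
    and \<A>: "\<And>K E. finite K \<Longrightarrow> K \<noteq> {} \<Longrightarrow> K \<subseteq> I \<Longrightarrow> (\<And>i. i \<in> K \<Longrightarrow> E i \<in> sets (M' i)) \<Longrightarrow>
       (\<Inter>i\<in>K. V i -` E i \<inter> space M) \<in> \<A>"
    and \<B>: "\<And>K E. finite K \<Longrightarrow> K \<noteq> {} \<Longrightarrow> K \<subseteq> J \<Longrightarrow> (\<And>i. i \<in> K \<Longrightarrow> E i \<in> sets (M' i)) \<Longrightarrow>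
       (\<Inter>i\<in>K. V i -` E i \<inter> space M) \<in> \<B>"
  shows "indep_vars M' V (I \<union> J)"
  unfolding indep_vars_def2
proof (intro conjI ballI)
  show rv: "random_variable (M' i) (V i)" if "i \<in> I \<union> J" for i
    using that V by (auto simp: indep_vars_def)
  show "indep_sets (\<lambda>i. {V i -` A \<inter> space M |A. A \<in> sets (M' i)}) (I \<union> J)"
  proof (rule indep_setsI)
    fix i assume "i \<in> I \<union> J"
    then show "{V i -` A \<inter> space M |A. A \<in> sets (M' i)} \<subseteq> events"
      using rv by (auto intro: measurable_sets)
  next
    fix F K assume K: "K \<noteq> {}" "K \<subseteq> I \<union> J" "finite K"
      and F: "\<forall>j\<in>K. F j \<in> {V j -` A \<inter> space M |A. A \<in> sets (M' j)}"
    from F have "\<forall>j\<in>K. \<exists>E. E \<in> sets (M' j) \<and> F j = V j -` E \<inter> space M" by blast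
    then obtain E where E: "\<And>j. j \<in> K \<Longrightarrow> E j \<in> sets (M' j)" "\<And>j. j \<in> K \<Longrightarrow> F j = V j -` E j \<inter> space M"
      by metis
    have FE: "(\<Inter>j\<in>L. F j) = (\<Inter>j\<in>L. V j -` E j \<inter> space M)" if "L \<subseteq> K" for L
      using that E by (intro INF_cong) auto
    define K1 K2 where "K1 = K \<inter> I" and "K2 = K - I"
    have K12: "finite K1" "finite K2" "K1 \<subseteq> I" "K2 \<subseteq> J" "K1 \<subseteq> K" "K2 \<subseteq> K" "K = K1 \<union> K2" "K1 \<inter> K2 = {}"
      using K by (auto simp: K1_def K2_def)
    have P1: "prob (\<Inter>j\<in>K1. F j) = (\<Prod>j\<in>K1. prob (F j))" if "K1 \<noteq> {}"
      unfolding FE[OF K12(5)] using K12 E that indep_varsD[OF V(1), of K1 E] by (auto intro!: prod.cong)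
    have P2: "prob (\<Inter>j\<in>K2. F j) = (\<Prod>j\<in>K2. prob (F j))" if "K2 \<noteq> {}"
      unfolding FE[OF K12(6)] using K12 E that indep_varsD[OF V(2), of K2 E] by (auto intro!: prod.cong)
    show "prob (\<Inter>j\<in>K. F j) = (\<Prod>j\<in>K. prob (F j))"
    proof (cases "K1 = {} \<or> K2 = {}")
      case True
      then show ?thesis
      proof
        assume "K1 = {}" then show ?thesis using P2 K(1) K12(7) by simp
      next
        assume "K2 = {}" then show ?thesis using P1 K(1) K12(7) by simp
      qed
    next
      case False
      have "prob ((\<Inter>j\<in>K1. F j) \<inter> (\<Inter>j\<in>K2. F j)) = prob (\<Inter>j\<in>K1. F j) * prob (\<Inter>j\<in>K2. F j)"
      proof (rule indep_setD[OF ind])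
        show "(\<Inter>j\<in>K1. F j) \<in> \<A>" unfolding FE[OF K12(5)] using K12 E False by (intro \<A>) auto
        show "(\<Inter>j\<in>K2. F j) \<in> \<B>" unfolding FE[OF K12(6)] using K12 E False by (intro \<B>) auto
      qed
      moreover have "(\<Inter>j\<in>K. F j) = (\<Inter>j\<in>K1. F j) \<inter> (\<Inter>j\<in>K2. F j)" using K12(7) by auto
      ultimately show ?thesis
        using P1 P2 False K12 by (simp add: prod.union_disjoint)
    qed
  qed
qed

section \<open>Moments of a compound Poisson sum\<close>

context
  fixes \<nu> :: "'a \<Rightarrow> nat" and g :: "nat \<Rightarrow> 'a \<Rightarrow> real" and lam B m1 m2 m3 :: real
  assumes lam: "lam > 0"
    and ind: "indep_vars (\<lambda>_. borel) (case_nat (\<lambda>\<omega>. real (\<nu> \<omega>)) g) UNIV"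
    and \<nu>: "random_variable (count_space UNIV) \<nu>" "distr M (count_space UNIV) \<nu> = measure_pmf (poisson_pmf lam)"
    and g: "\<And>i \<omega>. 0 \<le> g i \<omega>" "\<And>i \<omega>. g i \<omega> \<le> B"
    and m1: "\<And>i. expectation (g i) = m1"
    and m2: "\<And>i. expectation (\<lambda>\<omega>. (g i \<omega>)\<^sup>2) = m2"
    and m3: "\<And>i. expectation (\<lambda>\<omega>. g i \<omega> ^ 3) = m3"
begin

lemma summand_measurable [measurable]: "random_variable borel (g i)"
  using ind[unfolded indep_vars_def] by (auto dest!: spec[of _ "Suc i"])

lemma moments_nonneg: "m1 \<ge> 0" "m2 \<ge> 0" "m3 \<ge> 0"
  using m1[of 0] m2[of 0] m3[of 0] g(1) by (auto intro!: integral_nonneg)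

abbreviation "partial \<equiv> partial_sum g"

lemma partial_measurable [measurable]: "random_variable borel (partial n)"
  unfolding partial_sum_def by measurable

lemma partial_bounds: "0 \<le> partial n \<omega>" "partial n \<omega> \<le> n * B"
  unfolding partial_sum_def using g sum_mono[of "{..<n}" "\<lambda>i. g i \<omega>" "\<lambda>_. B"] by (auto intro: sum_nonneg)

lemma integrable_partial_power: "integrable M (\<lambda>\<omega>. partial n \<omega> ^ k)"
  using partial_bounds
  by (intro integrable_const_bound[where B="(n * B) ^ k"]) (auto intro!: power_mono)

lemma integrable_g_power: "integrable M (\<lambda>\<omega>. g i \<omega> ^ k)"
  using g by (intro integrable_const_bound[where B="B ^ k"]) (auto intro!: power_mono)

text \<open>In the joint family index 0 holds the count and index \<open>Suc i\<close> the summand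
  \<open>g i\<close>; a partial sum therefore avoids index 0 and is independent of the
  count.\<close>

lemma partial_eq: "partial n \<omega> = (\<Sum>i\<in>{1..n}. case_nat (\<lambda>\<omega>. real (\<nu> \<omega>)) g i \<omega>)"
  unfolding partial_sum_def
  by (rule sum.reindex_bij_witness[where i="\<lambda>i. i - 1" and j=Suc]) auto

lemma indep_partial:
  assumes "i = 0 \<or> i > n"
  shows "indep_var borel (case_nat (\<lambda>\<omega>. real (\<nu> \<omega>)) g i) borel (partial n)"
  unfolding partial_eq[abs_def] using assms
  by (intro indep_vars_sum indep_vars_subset[OF ind]) auto

lemma expectation_partial_1: "expectation (partial n) = n * m1"
  unfolding partial_sum_def using m1 integrable_g_power[of _ 1] by simp

text \<open>Written as \<open>n\<close> times a function of \<open>n - 1\<close>, the form to which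
  the size-bias identity applies. The truncated subtraction at \<open>n = 0\<close> is harmless
  because of the factor \<open>n\<close>.\<close>

lemma expectation_partial_2: "expectation (\<lambda>\<omega>. (partial n \<omega>)\<^sup>2) = n * (m2 + real (n - 1) * m1\<^sup>2)"
proof (induction n)
  case (Suc n)
  have ip: "indep_var borel (g n) borel (partial n)" using indep_partial[of "Suc n" n] by simp
  have "expectation (\<lambda>\<omega>. g n \<omega> * partial n \<omega>) = m1 * (n * m1)"
    using indep_var_lebesgue_integral[OF ip] integrable_g_power[of n 1] integrable_partial_power[of n 1]
    by (simp add: m1 expectation_partial_1)
  moreover have "integrable M (\<lambda>\<omega>. g n \<omega> * partial n \<omega>)"
    using indep_var_integrable[OF ip] integrable_g_power[of n 1] integrable_partial_power[of n 1] by simp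
  moreover have "(\<lambda>\<omega>. (partial (Suc n) \<omega>)\<^sup>2) = (\<lambda>\<omega>. (partial n \<omega>)\<^sup>2 + 2 * (g n \<omega> * partial n \<omega>) + (g n \<omega>)\<^sup>2)"
    by (simp add: partial_sum_def fun_eq_iff power2_eq_square algebra_simps)
  ultimately have "expectation (\<lambda>\<omega>. (partial (Suc n) \<omega>)\<^sup>2) = expectation (\<lambda>\<omega>. (partial n \<omega>)\<^sup>2) + 2 * (m1 * (n * m1)) + m2"
    using integrable_g_power[of n 2] integrable_partial_power[of n 2] by (simp add: m2)
  then show ?case unfolding Suc.IH by (cases n) (auto simp: power2_eq_square algebra_simps)
qed (simp add: partial_sum_def)

text \<open>An upper bound suffices for the third moment, and the power mean inequality gives one
  without expanding mixed terms.\<close>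

lemma expectation_partial_3: "expectation (\<lambda>\<omega>. partial n \<omega> ^ 3) \<le> real n ^ 3 * m3"
proof -
  have "expectation (\<lambda>\<omega>. partial n \<omega> ^ 3) \<le> expectation (\<lambda>\<omega>. (real n)\<^sup>2 * (\<Sum>i<n. g i \<omega> ^ 3))"
    using sum_cubed_le[of "{..<n}"] g integrable_partial_power integrable_g_power
    by (intro integral_mono) (auto simp: partial_sum_def)
  also have "\<dots> = real n ^ 3 * m3"
    using integrable_g_power by (simp add: m3) (simp add: power2_eq_square power3_eq_cube)
  finally show ?thesis .
qed

abbreviation "compound \<equiv> random_sum \<nu> g"

lemma compound_measurable [measurable]: "random_variable borel compound"
  unfolding random_sum_def[abs_def]
  by (rule measurable_compose_countable[OF partial_measurable \<nu>(1)])

lemma compound_nonneg: "compound \<omega> \<ge> 0"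
  by (simp add: random_sum_def partial_bounds)

text \<open>Conditioning on the count: the space is cut into the events \<open>\<nu> = n\<close>, on
  each of which the sum has a fixed length and is independent of the event.\<close>

lemma nn_integral_compound_power:
  "(\<integral>\<^sup>+\<omega>. ennreal (compound \<omega> ^ k) \<partial>M)
     = (\<integral>\<^sup>+n. ennreal (expectation (\<lambda>\<omega>. partial n \<omega> ^ k)) \<partial>poisson_pmf lam)"
proof -
  note [measurable] = \<nu>(1)
  have ev [measurable]: "\<nu> -` {n} \<inter> space M \<in> events" for n
    by (rule measurable_sets[OF \<nu>(1)]) simp
  have "(\<integral>\<^sup>+\<omega>. ennreal (compound \<omega> ^ k) \<partial>M)
     = (\<integral>\<^sup>+\<omega>. (\<Sum>n. indicator (\<nu> -` {n} \<inter> space M) \<omega> * ennreal (partial n \<omega> ^ k)) \<partial>M)"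
  proof (rule nn_integral_cong)
    fix \<omega> assume "\<omega> \<in> space M"
    then have "(\<Sum>n. indicator (\<nu> -` {n} \<inter> space M) \<omega> * ennreal (partial n \<omega> ^ k))
       = (\<Sum>n\<in>{\<nu> \<omega>}. indicator (\<nu> -` {n} \<inter> space M) \<omega> * ennreal (partial n \<omega> ^ k))"
      by (intro suminf_finite) (auto simp: indicator_def)
    with \<open>\<omega> \<in> space M\<close> show "ennreal (compound \<omega> ^ k)
       = (\<Sum>n. indicator (\<nu> -` {n} \<inter> space M) \<omega> * ennreal (partial n \<omega> ^ k))"
      by (simp add: random_sum_def)
  qed
  also have "\<dots> = (\<Sum>n. \<integral>\<^sup>+\<omega>. indicator (\<nu> -` {n} \<inter> space M) \<omega> * ennreal (partial n \<omega> ^ k) \<partial>M)"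
    by (intro nn_integral_suminf) measurable
  also have "\<dots> = (\<Sum>n. ennreal (pmf (poisson_pmf lam) n) * ennreal (expectation (\<lambda>\<omega>. partial n \<omega> ^ k)))"
  proof (intro suminf_cong)
    fix n
    have "indep_var borel ((\<lambda>x. indicator {real n} x :: real) \<circ> case_nat (\<lambda>\<omega>. real (\<nu> \<omega>)) g 0) borel ((\<lambda>x. x ^ k) \<circ> partial n)"
      by (rule indep_var_compose[OF indep_partial]) auto
    then have i: "indep_var borel (\<lambda>\<omega>. indicat_real {n} (\<nu> \<omega>) :: real) borel (\<lambda>\<omega>. partial n \<omega> ^ k)"
      by (simp add: comp_def indicator_def)
    have i1: "integrable M (\<lambda>\<omega>. indicat_real {n} (\<nu> \<omega>) :: real)"
      by (rule integrable_const_bound[where B=1]) (auto intro!: measurable_compose[OF \<nu>(1)])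
    have "(\<integral>\<^sup>+\<omega>. indicator (\<nu> -` {n} \<inter> space M) \<omega> * ennreal (partial n \<omega> ^ k) \<partial>M)
       = (\<integral>\<^sup>+\<omega>. ennreal (indicat_real {n} (\<nu> \<omega>) * partial n \<omega> ^ k) \<partial>M)"
      by (intro nn_integral_cong) (auto simp: indicator_def)
    also have "\<dots> = ennreal (expectation (\<lambda>\<omega>. indicat_real {n} (\<nu> \<omega>) * partial n \<omega> ^ k))"
      using partial_bounds indep_var_integrable[OF i i1 integrable_partial_power]
      by (intro nn_integral_eq_integral) auto
    also have "expectation (\<lambda>\<omega>. indicat_real {n} (\<nu> \<omega>) * partial n \<omega> ^ k)
       = expectation (\<lambda>\<omega>. indicat_real {n} (\<nu> \<omega>)) * expectation (\<lambda>\<omega>. partial n \<omega> ^ k)"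
      by (rule indep_var_lebesgue_integral[OF i i1 integrable_partial_power])
    also have "expectation (\<lambda>\<omega>. indicat_real {n} (\<nu> \<omega>)) = (\<integral>j. indicat_real {n} j \<partial>distr M (count_space UNIV) \<nu>)"
      using \<nu>(1) by (subst integral_distr) auto
    also have "\<dots> = pmf (poisson_pmf lam) n"
      unfolding \<nu>(2) by (simp add: measure_pmf_single)
    finally show "(\<integral>\<^sup>+\<omega>. indicator (\<nu> -` {n} \<inter> space M) \<omega> * ennreal (partial n \<omega> ^ k) \<partial>M)
       = ennreal (pmf (poisson_pmf lam) n) * ennreal (expectation (\<lambda>\<omega>. partial n \<omega> ^ k))"
      using partial_bounds by (simp add: ennreal_mult)
  qed
  also have "\<dots> = (\<integral>\<^sup>+n. ennreal (expectation (\<lambda>\<omega>. partial n \<omega> ^ k)) \<partial>poisson_pmf lam)"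
    by (simp add: nn_integral_measure_pmf nn_integral_count_space_nat)
  finally show ?thesis .
qed

text \<open>In the variance the squared mean \<open>(lam * m1)^2\<close> cancels and only the second
  moment of a summand remains. The factor in the last bound is the third moment of the Poisson
  law.\<close>

lemma compound_moments:
  "integrable M compound" "integrable M (\<lambda>\<omega>. (compound \<omega>)\<^sup>2)" "integrable M (\<lambda>\<omega>. compound \<omega> ^ 3)"
  "expectation compound = lam * m1"
  "variance compound = lam * m2"
  "expectation (\<lambda>\<omega>. compound \<omega> ^ 3) \<le> lam * (lam\<^sup>2 + 3 * lam + 1) * m3"
proof -
  have n1: "(\<integral>\<^sup>+\<omega>. ennreal (compound \<omega> ^ 1) \<partial>M) = ennreal (lam * m1)"
  proof -
    have "(\<integral>\<^sup>+\<omega>. ennreal (compound \<omega> ^ 1) \<partial>M) = (\<integral>\<^sup>+n. of_nat n * ennreal m1 \<partial>poisson_pmf lam)"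
      unfolding nn_integral_compound_power using moments_nonneg
      by (intro nn_integral_cong) (simp add: expectation_partial_1 ennreal_mult ennreal_of_nat_eq_real_of_nat)
    then show ?thesis using lam moments_nonneg by (simp add: nn_integral_multc nn_integral_poisson_1 ennreal_mult)
  qed
  have n2: "(\<integral>\<^sup>+\<omega>. ennreal (compound \<omega> ^ 2) \<partial>M) = ennreal (lam * (m2 + lam * m1\<^sup>2))"
  proof -
    have "(\<integral>\<^sup>+\<omega>. ennreal (compound \<omega> ^ 2) \<partial>M)
       = (\<integral>\<^sup>+n. of_nat n * (ennreal m2 + of_nat (n - 1) * ennreal (m1\<^sup>2)) \<partial>poisson_pmf lam)"
      unfolding nn_integral_compound_power using moments_nonneg
      by (intro nn_integral_cong)
         (simp add: expectation_partial_2 ennreal_mult ennreal_of_nat_eq_real_of_nat)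
    also have "\<dots> = ennreal lam * (ennreal m2 + ennreal lam * ennreal (m1\<^sup>2))"
      by (subst nn_integral_poisson_size_bias[OF lam, where \<phi>="\<lambda>j. ennreal m2 + of_nat j * ennreal (m1\<^sup>2)"])
         (simp add: nn_integral_add nn_integral_multc nn_integral_poisson_1[OF lam] measure_pmf.emeasure_space_1[simplified])
    finally show ?thesis using lam moments_nonneg by (simp add: ennreal_mult)
  qed
  have n3: "(\<integral>\<^sup>+\<omega>. ennreal (compound \<omega> ^ 3) \<partial>M) \<le> ennreal (lam * (lam\<^sup>2 + 3 * lam + 1) * m3)"
  proof -
    have "(\<integral>\<^sup>+\<omega>. ennreal (compound \<omega> ^ 3) \<partial>M)
       \<le> (\<integral>\<^sup>+n. (of_nat n * (of_nat n * of_nat n)) * ennreal m3 \<partial>poisson_pmf lam)"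
      unfolding nn_integral_compound_power
    proof (rule nn_integral_mono)
      fix n
      have "ennreal (expectation (\<lambda>\<omega>. partial n \<omega> ^ 3)) \<le> ennreal (real n ^ 3 * m3)"
        by (rule ennreal_leI[OF expectation_partial_3])
      then show "ennreal (expectation (\<lambda>\<omega>. partial n \<omega> ^ 3)) \<le> (of_nat n * (of_nat n * of_nat n)) * ennreal m3"
        using moments_nonneg by (simp add: power3_eq_cube ennreal_mult ennreal_of_nat_eq_real_of_nat mult.assoc)
    qed
    also have "\<dots> = ennreal (lam * (lam\<^sup>2 + 3 * lam + 1)) * ennreal m3"
      using lam by (simp add: nn_integral_multc nn_integral_poisson_3)
    finally show ?thesis using lam moments_nonneg by (simp add: ennreal_mult[symmetric])
  qed
  have i: "integrable M (\<lambda>\<omega>. compound \<omega> ^ k)" if "(\<integral>\<^sup>+\<omega>. ennreal (compound \<omega> ^ k) \<partial>M) < \<infinity>" for k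
    using that compound_nonneg by (intro integrableI_nonneg) auto
  have e: "expectation (\<lambda>\<omega>. compound \<omega> ^ k) = enn2real (\<integral>\<^sup>+\<omega>. ennreal (compound \<omega> ^ k) \<partial>M)" for k
    using compound_nonneg by (intro integral_eq_nn_integral) auto
  show 1: "integrable M compound" using i[of 1] n1 by simp
  show 2: "integrable M (\<lambda>\<omega>. (compound \<omega>)\<^sup>2)" using i[of 2] n2 by simp
  show 3: "integrable M (\<lambda>\<omega>. compound \<omega> ^ 3)" using i[of 3] n3 by (simp add: order_le_less_trans)
  show e1: "expectation compound = lam * m1" using e[of 1] n1 lam moments_nonneg by simp
  have e2: "expectation (\<lambda>\<omega>. (compound \<omega>)\<^sup>2) = lam * (m2 + lam * m1\<^sup>2)" using e[of 2] n2 lam moments_nonneg by simp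
  show "variance compound = lam * m2"
    using variance_eq[OF 1 2] e1 e2 by (simp add: power2_eq_square algebra_simps)
  show "expectation (\<lambda>\<omega>. compound \<omega> ^ 3) \<le> lam * (lam\<^sup>2 + 3 * lam + 1) * m3"
    unfolding e using n3 lam moments_nonneg by (intro enn2real_leI) auto
qed

text \<open>For nonnegative reals \<open>|a - b|^3 \<le> a^3 + b^3\<close>; the cube of the mean is
  at most the third moment, hence the factor 2.\<close>

lemma compound_third_central_moment:
  "integrable M (\<lambda>\<omega>. \<bar>compound \<omega> - expectation compound\<bar> ^ 3)"
  "expectation (\<lambda>\<omega>. \<bar>compound \<omega> - expectation compound\<bar> ^ 3) \<le> 2 * (lam * (lam\<^sup>2 + 3 * lam + 1)) * m3"
proof -
  note cm = compound_moments
  have E: "expectation compound \<ge> 0" using compound_nonneg by simp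
  have le: "\<bar>compound \<omega> - expectation compound\<bar> ^ 3 \<le> compound \<omega> ^ 3 + expectation compound ^ 3" for \<omega>
    by (rule abs_diff_cubed_le[OF compound_nonneg E])
  have int: "integrable M (\<lambda>\<omega>. compound \<omega> ^ 3 + expectation compound ^ 3)" using cm(3) by simp
  show I: "integrable M (\<lambda>\<omega>. \<bar>compound \<omega> - expectation compound\<bar> ^ 3)"
    by (rule Bochner_Integration.integrable_bound[OF int])
       (use le compound_nonneg E in \<open>auto intro!: AE_I2\<close>)
  have "expectation (\<lambda>\<omega>. \<bar>compound \<omega> - expectation compound\<bar> ^ 3) \<le> expectation (\<lambda>\<omega>. compound \<omega> ^ 3 + expectation compound ^ 3)"
    by (rule integral_mono[OF I int le])
  also have "\<dots> = expectation (\<lambda>\<omega>. compound \<omega> ^ 3) + expectation compound ^ 3"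
    using cm(3) by (simp add: prob_space)
  also have "\<dots> \<le> 2 * expectation (\<lambda>\<omega>. compound \<omega> ^ 3)"
    using cube_expectation_le[OF compound_measurable compound_nonneg cm(1,3)] by simp
  also have "\<dots> \<le> 2 * (lam * (lam\<^sup>2 + 3 * lam + 1) * m3)"
    using cm(6) by simp
  finally show "expectation (\<lambda>\<omega>. \<bar>compound \<omega> - expectation compound\<bar> ^ 3) \<le> 2 * (lam * (lam\<^sup>2 + 3 * lam + 1)) * m3"
    by simp
qed

end

end

section \<open>The particle field\<close>

text \<open>\<open>V\<close> agrees with the sum only almost surely, so mean and variance are
  transferred first. Then \<open>standardized V\<close> is almost surely the sum of the
  \<open>Y i\<close>, which are centred with total variance 1.\<close>

lemma (in prob_space) wasserstein_standardized_indep_sum_le: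
  fixes T :: "'i \<Rightarrow> 'a \<Rightarrow> real" and V :: "'a \<Rightarrow> real" and Q :: "'z measure"
  assumes I: "finite I" and ind: "indep_vars (\<lambda>_. borel) T I"
    and int1: "\<And>i. i \<in> I \<Longrightarrow> integrable M (T i)"
    and int3: "\<And>i. i \<in> I \<Longrightarrow> integrable M (\<lambda>\<omega>. \<bar>T i \<omega> - expectation (T i)\<bar> ^ 3)"
    and V [measurable]: "random_variable borel V" and VT: "AE \<omega> in M. V \<omega> = (\<Sum>i\<in>I. T i \<omega>)"
    and v: "v = (\<Sum>i\<in>I. variance (T i))" "v > 0"
    and Z: "distributed Q lborel Z std_normal_density"
  shows "wasserstein M (standardized V) Q Z
    \<le> ereal (16 * (\<Sum>i\<in>I. expectation (\<lambda>\<omega>. \<bar>T i \<omega> - expectation (T i)\<bar> ^ 3)) / sqrt v ^ 3)"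
proof -
  define C where "C i \<omega> = T i \<omega> - expectation (T i)" for i \<omega>
  define Y where "Y i \<omega> = C i \<omega> / sqrt v" for i \<omega>
  have Tm: "random_variable borel (T i)" if "i \<in> I" for i using ind that by (simp add: indep_vars_def)
  have Cind: "indep_vars (\<lambda>_. borel) C I"
    unfolding C_def[abs_def] by (rule indep_vars_compose2[OF ind, of "\<lambda>i x. x - expectation (T i)"]) simp
  have Yind: "indep_vars (\<lambda>_. borel) Y I"
    unfolding Y_def[abs_def] by (rule indep_vars_compose2[OF Cind, of "\<lambda>i x. x / sqrt v"]) simp
  have Cm: "random_variable borel (C i)" if "i \<in> I" for i using Cind that by (simp add: indep_vars_def)
  have C3: "integrable M (\<lambda>\<omega>. \<bar>C i \<omega>\<bar> ^ 3)" if "i \<in> I" for i using int3[OF that] by (simp add: C_def)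
  have C1: "integrable M (C i)" if "i \<in> I" for i using int1[OF that] by (simp add: C_def[abs_def])
  have C2: "integrable M (\<lambda>\<omega>. (C i \<omega>)\<^sup>2)" if "i \<in> I" for i
    using integrable_lower_power[OF Cm[OF that] C3[OF that], of 2] by simp
  have C0: "expectation (C i) = 0" if "i \<in> I" for i
    using int1[OF that] by (simp add: C_def[abs_def] prob_space)
  have vC: "v = (\<Sum>i\<in>I. expectation (\<lambda>\<omega>. (C i \<omega>)\<^sup>2))" by (simp add: v C_def)
  have EV: "expectation V = (\<Sum>i\<in>I. expectation (T i))"
  proof -
    have "expectation V = expectation (\<lambda>\<omega>. \<Sum>i\<in>I. T i \<omega>)"
      by (rule integral_cong_AE) (use VT Tm in auto)
    then show ?thesis using int1 by simp
  qed
  have VC: "AE \<omega> in M. V \<omega> - expectation V = (\<Sum>i\<in>I. C i \<omega>)"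
    using VT by eventually_elim (simp add: EV C_def sum_subtractf)
  have "variance V = expectation (\<lambda>\<omega>. (\<Sum>i\<in>I. C i \<omega>)\<^sup>2)"
    by (rule integral_cong_AE) (use VC Cm in auto)
  also have "\<dots> = v"
    unfolding vC using indep_vars_sum_square[OF I Cind C1 C2 C0] by blast
  finally have varV: "variance V = v" .
  have stdV: "AE \<omega> in M. standardized V \<omega> = (\<Sum>i\<in>I. Y i \<omega>)"
    using VC by eventually_elim (simp add: standardized_def varV Y_def sum_divide_distrib)
  have Ym: "random_variable borel (Y i)" if "i \<in> I" for i using Yind that by (simp add: indep_vars_def)
  have Y3: "(\<lambda>\<omega>. \<bar>Y i \<omega>\<bar> ^ 3) = (\<lambda>\<omega>. \<bar>C i \<omega>\<bar> ^ 3 / sqrt v ^ 3)" for i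
    using v(2) by (simp add: Y_def power_divide abs_divide)
  show ?thesis
    unfolding wasserstein_def
  proof (rule SUP_least)
    fix h :: "real \<Rightarrow> real" assume "h \<in> {h. 1-lipschitz_on UNIV h}"
    then have h: "1-lipschitz_on UNIV h" by simp
    note [measurable] = lipschitz_borel_measurable[OF h]
    have "(\<integral>\<omega>. h (Z \<omega>) \<partial>Q) = (LINT s|lborel. gauss s * h s)"
      by (rule distributed_integral[OF Z, symmetric]) auto
    moreover have "(\<integral>\<omega>. h (standardized V \<omega>) \<partial>M) = expectation (\<lambda>\<omega>. h (\<Sum>i\<in>I. Y i \<omega>))"
    proof (rule integral_cong_AE)
      show "(\<lambda>\<omega>. h (standardized V \<omega>)) \<in> borel_measurable M"
        unfolding standardized_def by measurable
      have "random_variable borel (\<lambda>\<omega>. \<Sum>i\<in>I. Y i \<omega>)" using Ym by auto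
      then show "(\<lambda>\<omega>. h (\<Sum>i\<in>I. Y i \<omega>)) \<in> borel_measurable M" by measurable
      show "AE \<omega> in M. h (standardized V \<omega>) = h (\<Sum>i\<in>I. Y i \<omega>)" using stdV by eventually_elim simp
    qed
    moreover have "\<bar>expectation (\<lambda>\<omega>. h (\<Sum>i\<in>I. Y i \<omega>)) - (LINT s|lborel. gauss s * h s)\<bar>
      \<le> 16 * (\<Sum>i\<in>I. expectation (\<lambda>\<omega>. \<bar>Y i \<omega>\<bar> ^ 3))"
    proof (rule stein_bound_indep_sum[OF I Yind _ _ _ h])
      show "integrable M (\<lambda>\<omega>. \<bar>Y i \<omega>\<bar> ^ 3)" if "i \<in> I" for i unfolding Y3 using C3[OF that] by simp
      show "expectation (Y i) = 0" if "i \<in> I" for i using C0[OF that] by (simp add: Y_def[abs_def])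
      have "(\<Sum>i\<in>I. expectation (\<lambda>\<omega>. (Y i \<omega>)\<^sup>2)) = (\<Sum>i\<in>I. expectation (\<lambda>\<omega>. (C i \<omega>)\<^sup>2)) / v"
        using v(2) by (simp add: Y_def power_divide sum_divide_distrib)
      then show "(\<Sum>i\<in>I. expectation (\<lambda>\<omega>. (Y i \<omega>)\<^sup>2)) = 1" using v(2) vC by simp
    qed
    ultimately show "ereal \<bar>(\<integral>\<omega>. h (standardized V \<omega>) \<partial>M) - (\<integral>\<omega>. h (Z \<omega>) \<partial>Q)\<bar>
      \<le> ereal (16 * (\<Sum>i\<in>I. expectation (\<lambda>\<omega>. \<bar>T i \<omega> - expectation (T i)\<bar> ^ 3)) / sqrt v ^ 3)"
      unfolding Y3 by (simp add: C_def sum_divide_distrib[symmetric])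
  qed
qed

text \<open>No summability is assumed: where the sum diverges both sides take the default value 0.
  Measurability of sums over sites thus follows from that of integrals with a parameter, including
  on the exceptional null set.\<close>

lemma infsum_eq_lebesgue_integral_count_space:
  fixes f :: "'i \<Rightarrow> real"
  shows "infsum f UNIV = (\<integral>y. f y \<partial>count_space UNIV)"
proof (cases "integrable (count_space UNIV) f")
  case True
  then have "infsetsum f UNIV = infsum f UNIV"
    by (intro infsetsum_infsum) (simp add: Infinite_Set_Sum.abs_summable_on_def)
  then show ?thesis by (simp add: infsetsum_def)
next
  case False
  then have "\<not> f summable_on UNIV"
    unfolding Infinite_Set_Sum.abs_summable_on_def[symmetric] abs_summable_equivalent[symmetric]
      summable_on_iff_abs_summable_on_real[of f] .
  with False show ?thesis by (simp add: infsum_not_exists not_integrable_integral_eq)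
qed

lemma borel_measurable_infsum:
  fixes f :: "'i :: countable \<Rightarrow> 'a \<Rightarrow> real"
  assumes f: "\<And>y. f y \<in> borel_measurable M"
  shows "(\<lambda>\<omega>. \<Sum>\<^sub>\<infinity>y\<in>UNIV. f y \<omega>) \<in> borel_measurable M"
  unfolding infsum_eq_lebesgue_integral_count_space
proof (rule sigma_finite_measure.borel_measurable_lebesgue_integral)
  show "sigma_finite_measure (count_space (UNIV :: 'i set))"
    by (rule sigma_finite_measure_count_space)
  have "(\<lambda>p. f (snd p) (fst p)) \<in> borel_measurable (M \<Otimes>\<^sub>M count_space UNIV)"
    by (rule measurable_compose_countable[where f="\<lambda>y p. f y (fst p)" and g=snd])
       (use f in \<open>auto intro: measurable_compose[OF measurable_fst]\<close>)
  then show "(\<lambda>(\<omega>, y). f y \<omega>) \<in> borel_measurable (M \<Otimes>\<^sub>M count_space UNIV)"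
    by (simp add: case_prod_beta)
qed

context poisson_walk_field begin

lemma xi0_measurable: "random_variable (count_space UNIV) (\<xi>0 y)"
  using indep_initial by (simp add: indep_vars_def)

lemma X_measurable: "i \<ge> 1 \<Longrightarrow> random_variable (count_space UNIV) (X y i n)"
  using random_variable_simple_symmetric_rw[OF rw_walks] .

lemma AE_walks_dist: "AE \<omega> in M. \<forall>y. \<forall>i\<ge>1. \<forall>n. \<bar>X y i n \<omega> - y\<bar> \<le> int n"
  unfolding AE_all_countable
proof (intro allI)
  show "AE \<omega> in M. i \<ge> 1 \<longrightarrow> (\<forall>n. \<bar>X y i n \<omega> - y\<bar> \<le> int n)" for y i
    using AE_simple_symmetric_rw_dist[OF rw_walks, of i y] by (cases "i \<ge> 1") auto
qed

lemma particle_sum_measurable: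
  assumes "\<And>i. i \<ge> 1 \<Longrightarrow> random_variable borel (c i)"
  shows "random_variable borel (\<lambda>\<omega>. \<Sum>i = 1..\<xi>0 y \<omega>. c i \<omega> :: real)"
  by (rule measurable_compose_countable[OF _ xi0_measurable]) (use assms in auto)

lemma occupation_measurable: "random_variable borel (occupation \<xi>0 X n x)"
  unfolding occupation_def[abs_def]
  by (intro borel_measurable_infsum particle_sum_measurable measurable_compose[OF X_measurable]) auto

lemma cumulative_occupation_measurable: "random_variable borel (cumulative_occupation \<xi>0 X A N)"
  unfolding cumulative_occupation_def[abs_def]
  using occupation_measurable by (intro borel_measurable_sum)

lemma distinct_visitors_measurable: "random_variable borel (distinct_visitors \<xi>0 X A N)"
  unfolding distinct_visitors_def[abs_def]
proof (intro borel_measurable_infsum particle_sum_measurable)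
  fix y i assume i: "(1 :: nat) \<le> i"
  have [measurable]: "Measurable.pred M (\<lambda>\<omega>. X y i m \<omega> \<in> A)" for m
    by (rule measurable_compose[OF X_measurable[OF i]]) simp
  show "random_variable borel (\<lambda>\<omega>. of_bool (\<exists>m\<in>{1..N}. X y i m \<omega> \<in> A) :: real)"
    unfolding of_bool_def by measurable
qed

definition visit_count :: "int set \<Rightarrow> nat \<Rightarrow> int \<Rightarrow> nat \<Rightarrow> 'w \<Rightarrow> real" where
  "visit_count A N y i \<omega> = (\<Sum>n = 1..N. of_bool (X y i n \<omega> \<in> A))"

lemma visit_count_bounds: "0 \<le> visit_count A N y i \<omega>" "visit_count A N y i \<omega> \<le> N"
proof -
  show "0 \<le> visit_count A N y i \<omega>" by (simp add: visit_count_def sum_nonneg)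
  have "visit_count A N y i \<omega> \<le> (\<Sum>n = 1..N. 1)" unfolding visit_count_def by (intro sum_mono) auto
  then show "visit_count A N y i \<omega> \<le> N" by simp
qed

lemma visit_count_eq_visits:
  "i \<ge> 1 \<Longrightarrow> \<omega> \<in> space M \<Longrightarrow> visit_count A N y i \<omega> = visits A y (increments N (\<lambda>n. X y i n \<omega>))"
  unfolding visit_count_def
  by (rule visits_increments[symmetric]) (rule simple_symmetric_rw_start[OF rw_walks])

lemma expectation_visit_count:
  assumes "i \<ge> 1"
  shows "expectation (\<lambda>\<omega>. \<phi> (visit_count A N y i \<omega>)) = steps_mean N (\<lambda>l. \<phi> (visits A y l))"
proof -
  have "expectation (\<lambda>\<omega>. \<phi> (visit_count A N y i \<omega>))
      = expectation (\<lambda>\<omega>. \<phi> (visits A y (increments N (\<lambda>n. X y i n \<omega>))))"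
    using assms by (intro Bochner_Integration.integral_cong) (simp_all add: visit_count_eq_visits)
  also have "\<dots> = steps_mean N (\<lambda>l. \<phi> (visits A y l))"
    by (rule expectation_increments[OF rw_walks[OF assms]])
  finally show ?thesis .
qed

lemma infsum_particles_eq:
  assumes "\<And>y i. \<bar>y\<bar> > K \<Longrightarrow> i \<ge> 1 \<Longrightarrow> c y i = (0 :: real)"
  shows "(\<Sum>\<^sub>\<infinity>y\<in>UNIV. \<Sum>i = 1..\<xi>0 y \<omega>. c y i) = (\<Sum>y = -K..K. \<Sum>i = 1..\<xi>0 y \<omega>. c y i)"
proof -
  have "(\<Sum>\<^sub>\<infinity>y\<in>UNIV. \<Sum>i = 1..\<xi>0 y \<omega>. c y i) = (\<Sum>\<^sub>\<infinity>y\<in>{-K..K}. \<Sum>i = 1..\<xi>0 y \<omega>. c y i)"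
    by (rule infsum_cong_neutral) (auto intro!: sum.neutral assms simp: abs_if)
  then show ?thesis by simp
qed

lemma cumulative_occupation_eq:
  assumes A: "A \<subseteq> {-R..R}" and K: "K \<ge> R + int N"
  shows "AE \<omega> in M. cumulative_occupation \<xi>0 X A N \<omega> = (\<Sum>y = -K..K. \<Sum>i = 1..\<xi>0 y \<omega>. visit_count A N y i \<omega>)"
  using AE_walks_dist
proof eventually_elim
  case (elim \<omega>)
  have finA: "finite A" using A by (rule finite_subset) simp
  have occ: "occupation \<xi>0 X n x \<omega> = (\<Sum>y = -K..K. \<Sum>i = 1..\<xi>0 y \<omega>. of_bool (X y i n \<omega> = x))"
    if n: "n \<in> {1..N}" and x: "x \<in> A" for n x
    unfolding occupation_def
  proof (rule infsum_particles_eq)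
    fix y i assume y: "\<bar>y\<bar> > K" and i: "(1::nat) \<le> i"
    have 1: "\<bar>X y i n \<omega> - y\<bar> \<le> int n" using elim i by blast
    have "x \<in> {-R..R}" using x A by blast
    then have "\<bar>x\<bar> \<le> R" by (simp add: abs_le_iff)
    with 1 have "X y i n \<omega> \<noteq> x" using n y K by auto
    then show "of_bool (X y i n \<omega> = x) = (0 :: real)" by simp
  qed
  have "cumulative_occupation \<xi>0 X A N \<omega>
     = (\<Sum>n = 1..N. \<Sum>x\<in>A. \<Sum>y = -K..K. \<Sum>i = 1..\<xi>0 y \<omega>. of_bool (X y i n \<omega> = x))"
    unfolding cumulative_occupation_def by (intro sum.cong refl occ)
  also have "\<dots> = (\<Sum>y = -K..K. \<Sum>n = 1..N. \<Sum>x\<in>A. \<Sum>i = 1..\<xi>0 y \<omega>. of_bool (X y i n \<omega> = x))"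
    unfolding sum.swap[of _ "{-K..K}" A] unfolding sum.swap[of _ "{-K..K}" "{1..N}"] ..
  also have "\<dots> = (\<Sum>y = -K..K. \<Sum>i = 1..\<xi>0 y \<omega>. visit_count A N y i \<omega>)"
  proof (rule sum.cong[OF refl])
    fix y
    have "(\<Sum>x\<in>A. of_bool (X y i n \<omega> = x)) = (of_bool (X y i n \<omega> \<in> A) :: real)" for i n
      using finA by (simp add: of_bool_def sum.delta)
    then show "(\<Sum>n = 1..N. \<Sum>x\<in>A. \<Sum>i = 1..\<xi>0 y \<omega>. of_bool (X y i n \<omega> = x))
      = (\<Sum>i = 1..\<xi>0 y \<omega>. visit_count A N y i \<omega>)"
      unfolding visit_count_def sum.swap[of _ "{1..\<xi>0 y \<omega>}" A]
      by (subst sum.swap) simp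
  qed
  finally show ?case .
qed

lemma distinct_visitors_eq:
  assumes A: "A \<subseteq> {-R..R}" and K: "K \<ge> R + int N"
  shows "AE \<omega> in M. distinct_visitors \<xi>0 X A N \<omega>
    = (\<Sum>y = -K..K. \<Sum>i = 1..\<xi>0 y \<omega>. of_bool (visit_count A N y i \<omega> > 0))"
  using AE_walks_dist AE_space
proof eventually_elim
  case (elim \<omega>)
  have "distinct_visitors \<xi>0 X A N \<omega>
     = (\<Sum>y = -K..K. \<Sum>i = 1..\<xi>0 y \<omega>. of_bool (\<exists>m\<in>{1..N}. X y i m \<omega> \<in> A))"
    unfolding distinct_visitors_def
  proof (intro infsum_particles_eq)
    fix y i assume y: "\<bar>y\<bar> > K" and i: "(1::nat) \<le> i"
    have "X y i n \<omega> \<notin> A" if n: "n \<in> {1..N}" for n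
    proof
      assume "X y i n \<omega> \<in> A"
      then have "X y i n \<omega> \<in> {-R..R}" using A by blast
      then have "\<bar>X y i n \<omega>\<bar> \<le> R" by (simp add: abs_le_iff)
      moreover have "\<bar>X y i n \<omega> - y\<bar> \<le> int n" using elim i by blast
      ultimately show False using n y K by auto
    qed
    then show "of_bool (\<exists>m\<in>{1..N}. X y i m \<omega> \<in> A) = (0 :: real)" by auto
  qed
  also have "\<dots> = (\<Sum>y = -K..K. \<Sum>i = 1..\<xi>0 y \<omega>. of_bool (visit_count A N y i \<omega> > 0))"
  proof (intro sum.cong refl arg_cong[where f=of_bool])
    fix y i assume "i \<in> {1..\<xi>0 y \<omega>}"
    then have "i \<ge> 1" by simp
    then show "(\<exists>m\<in>{1..N}. X y i m \<omega> \<in> A) = (visit_count A N y i \<omega> > 0)"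
      using elim(2) by (simp add: visit_count_eq_visits visits_increments_pos_iff[where y=y] simple_symmetric_rw_start[OF rw_walks])
  qed
  finally show ?case .
qed

text \<open>Brings a finite intersection of coordinate events into the form of one preimage under
  the whole configuration, the form of the events in \<open>indep_initial_walks\<close>.\<close>

lemma INT_vimage_eq_vimage:
  assumes "L \<noteq> {}" "\<And>\<omega>. W \<omega> \<in> \<Omega>" "\<And>p \<omega>. p \<in> L \<Longrightarrow> U p \<omega> = G p (W \<omega>)"
  shows "(\<Inter>p\<in>L. U p -` E p \<inter> S) = W -` {z \<in> \<Omega>. \<forall>p\<in>L. G p z \<in> E p} \<inter> S"
  using assms by auto

text \<open>Putting particle numbers and walk functionals into one real-valued family lets
  \<open>indep_vars_restrict\<close> collect all the randomness attached to a site \<open>y\<close> into one block.\<close>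

lemma indep_particle_functionals:
  assumes f [measurable]: "f \<in> borel_measurable path_space"
  shows "indep_vars (\<lambda>_. borel)
    (\<lambda>(y, i) \<omega>. if i = 0 then real (\<xi>0 y \<omega>) else f (\<lambda>n. X y i n \<omega>)) (UNIV :: (int \<times> nat) set)"
proof -
  define U where "U = (\<lambda>(y, i) \<omega>. if i = 0 then real (\<xi>0 y \<omega>) else f (\<lambda>n. X y i n \<omega>))"
  let ?I = "UNIV \<times> {0} :: (int \<times> nat) set" and ?J = "UNIV \<times> {1..} :: (int \<times> nat) set"
  let ?P = "Pi\<^sub>M UNIV (\<lambda>_. count_space UNIV) :: (int \<Rightarrow> nat) measure"
  let ?R = "Pi\<^sub>M ?J (\<lambda>_. path_space)"
  have "indep_vars (\<lambda>_. borel) (\<lambda>y \<omega>. real (\<xi>0 y \<omega>)) UNIV"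
    by (rule indep_vars_compose2[OF indep_initial, of "\<lambda>_. real"]) simp
  \<comment> \<open>The counts are indexed by sites; pulling them back along \<open>fst\<close>
    places them at the pairs with second component 0, which no walk occupies.\<close>
  from indep_vars_reindex[OF this, of fst ?I]
  have "indep_vars (\<lambda>_. borel) (\<lambda>p \<omega>. real (\<xi>0 (fst p) \<omega>)) ?I" by (auto simp: inj_on_def)
  then have I: "indep_vars (\<lambda>_. borel) U ?I"
    by (rule indep_vars_cong[THEN iffD1, rotated -1]) (auto simp: U_def)
  have "indep_vars (\<lambda>_. borel) (\<lambda>p \<omega>. f ((\<lambda>(y, i) \<omega> n. X y i n \<omega>) p \<omega>)) ?J"
    by (rule indep_vars_compose2[OF indep_walks, of "\<lambda>_. f"]) simp
  then have J: "indep_vars (\<lambda>_. borel) U ?J"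
    by (rule indep_vars_cong[THEN iffD1, rotated -1]) (auto simp: U_def fun_eq_iff)
  have "indep_vars (\<lambda>_. borel) U (?I \<union> ?J)"
  proof (rule indep_vars_Un[OF I J indep_initial_walks])
    fix L and E :: "int \<times> nat \<Rightarrow> real set"
    assume L: "finite L" "L \<noteq> {}" "L \<subseteq> ?I" and E: "\<And>p. p \<in> L \<Longrightarrow> E p \<in> sets borel"
    let ?B = "{z \<in> space ?P. \<forall>p\<in>L. real (z (fst p)) \<in> E p}"
    have UL: "U p \<omega> = real (\<xi>0 (fst p) \<omega>)" if "p \<in> L" for p \<omega>
      using that L(3) by (auto simp: U_def)
    have "(\<Inter>p\<in>L. U p -` E p \<inter> space M) = (\<lambda>\<omega> y. \<xi>0 y \<omega>) -` ?B \<inter> space M"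
      by (rule INT_vimage_eq_vimage[OF L(2), where G="\<lambda>p z. real (z (fst p))"]) (simp_all add: UL space_PiM)
    moreover have "?B \<in> sets ?P"
    proof (rule sets.sets_Collect_finite_All[OF _ L(1)])
      fix p assume "p \<in> L"
      have "(\<lambda>z. real (z (fst p))) \<in> borel_measurable ?P"
        by (rule measurable_compose[OF measurable_component_singleton]) auto
      from measurable_sets[OF this E[OF \<open>p \<in> L\<close>]]
      show "{z \<in> space ?P. real (z (fst p)) \<in> E p} \<in> sets ?P" by (simp add: vimage_def Int_def conj_commute)
    qed
    ultimately show "(\<Inter>p\<in>L. U p -` E p \<inter> space M) \<in>
      {(\<lambda>\<omega> y. \<xi>0 y \<omega>) -` B \<inter> space M |B. B \<in> sets ?P}" by blast
  next
    fix L and E :: "int \<times> nat \<Rightarrow> real set"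
    assume L: "finite L" "L \<noteq> {}" "L \<subseteq> ?J" and E: "\<And>p. p \<in> L \<Longrightarrow> E p \<in> sets borel"
    let ?B = "{z \<in> space ?R. \<forall>p\<in>L. f (z p) \<in> E p}"
    let ?W = "\<lambda>\<omega>. \<lambda>(y, i)\<in>?J. \<lambda>n. X y i n \<omega>"
    have W: "?W \<omega> \<in> space ?R" for \<omega> by (auto simp: space_PiM)
    have UW: "U p \<omega> = f (?W \<omega> p)" if "p \<in> L" for p \<omega>
      using that L(3) by (cases p) (auto simp: U_def)
    have "(\<Inter>p\<in>L. U p -` E p \<inter> space M) = ?W -` ?B \<inter> space M"
      by (rule INT_vimage_eq_vimage[where G="\<lambda>p z. f (z p)", OF L(2) W UW])
    moreover have "?B \<in> sets ?R"
    proof (rule sets.sets_Collect_finite_All[OF _ L(1)])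
      fix p assume "p \<in> L"
      then have "p \<in> ?J" using L(3) by blast
      then have "(\<lambda>z. f (z p)) \<in> borel_measurable ?R"
        using measurable_compose[OF measurable_component_singleton[of p ?J "\<lambda>_. path_space"] f] by simp
      from measurable_sets[OF this E[OF \<open>p \<in> L\<close>]]
      show "{z \<in> space ?R. f (z p) \<in> E p} \<in> sets ?R" by (simp add: vimage_def Int_def conj_commute)
    qed
    ultimately show "(\<Inter>p\<in>L. U p -` E p \<inter> space M) \<in> {?W -` B \<inter> space M |B. B \<in> sets ?R}" by blast
  qed
  moreover have "?I \<union> ?J = UNIV" by (auto simp: Suc_le_eq)
  ultimately show ?thesis by (simp add: U_def)
qed

text \<open>Serves both functionals: \<open>\<phi>\<close> is the identity or the indicator of
  positive numbers. The factor 32 is 16 from Stein's bound times 2 from the third central moment,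
  and \<open>lam * ?v\<close> is the variance.\<close>

lemma wasserstein_particle_sum_le:
  fixes \<phi> :: "real \<Rightarrow> real" and Q :: "'z measure"
  assumes lam: "lam > 0" and \<phi> [measurable]: "\<phi> \<in> borel_measurable borel"
    and \<phi>b: "\<And>x. 0 \<le> x \<Longrightarrow> x \<le> N \<Longrightarrow> 0 \<le> \<phi> x \<and> \<phi> x \<le> B"
    and V: "random_variable borel V"
      "AE \<omega> in M. V \<omega> = (\<Sum>y = -K..K. \<Sum>i = 1..\<xi>0 y \<omega>. \<phi> (visit_count A N y i \<omega>))"
    and pos: "(\<Sum>y = -K..K. steps_mean N (\<lambda>l. \<phi> (visits A y l) ^ 2)) > 0" (is "?v > 0")
    and Z: "distributed Q lborel Z std_normal_density"
  shows "wasserstein M (standardized V) Q Z \<le> ereal (32 * (lam * (lam\<^sup>2 + 3 * lam + 1)) *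
     (\<Sum>y = -K..K. steps_mean N (\<lambda>l. \<phi> (visits A y l) ^ 3)) / sqrt (lam * ?v) ^ 3)"
proof -
  define f where "f p = \<phi> (\<Sum>n = 1..N. of_bool (p n \<in> A))" for p :: "nat \<Rightarrow> int"
  \<comment> \<open>Particles are labelled from 1, the summands of \<open>random_sum\<close> from
    0.\<close>
  define g where "g y i \<omega> = \<phi> (visit_count A N y (Suc i) \<omega>)" for y i \<omega>
  define m where "m y k = steps_mean N (\<lambda>l. \<phi> (visits A y l) ^ k)" for y and k :: nat
  define U where "U = (\<lambda>(y, i) \<omega>. if i = 0 then real (\<xi>0 y \<omega>) else f (\<lambda>n. X y i n \<omega>))"
  have gU: "g y i = U (y, Suc i)" for y i
    by (simp add: g_def U_def f_def visit_count_def fun_eq_iff)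
  have f: "f \<in> borel_measurable path_space"
  proof -
    have "(\<lambda>p. of_bool (p n \<in> A) :: real) \<in> borel_measurable path_space" for n
      by (rule measurable_compose[OF measurable_component_singleton[where i=n]]) auto
    then have "(\<lambda>p. \<Sum>n = 1..N. of_bool (p n \<in> A) :: real) \<in> borel_measurable path_space"
      by (intro borel_measurable_sum)
    then show ?thesis unfolding f_def by measurable
  qed
  have Uind: "indep_vars (\<lambda>_. borel) U UNIV"
    unfolding U_def by (rule indep_particle_functionals[OF f])
  have one: "indep_vars (\<lambda>_. borel) (case_nat (\<lambda>\<omega>. real (\<xi>0 y \<omega>)) (g y)) UNIV" for y
  proof -
    have "indep_vars (\<lambda>_. borel) (\<lambda>i. U (y, i)) UNIV"
      using indep_vars_reindex[OF Uind, of "Pair y" UNIV] by (simp add: inj_on_def)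
    moreover have "(\<lambda>i. U (y, i)) = case_nat (\<lambda>\<omega>. real (\<xi>0 y \<omega>)) (g y)"
      by (auto simp: fun_eq_iff gU U_def split: nat.split)
    ultimately show ?thesis by simp
  qed
  have gb: "0 \<le> g y i \<omega>" "g y i \<omega> \<le> B" for y i \<omega>
    using \<phi>b[OF visit_count_bounds] by (auto simp: g_def)
  have Eg: "expectation (\<lambda>\<omega>. g y i \<omega> ^ k) = m y k" for y i k
    unfolding g_def m_def by (rule expectation_visit_count) simp
  note mom = lam one xi0_measurable poisson_initial gb Eg[of _ _ 1, unfolded power_one_right] Eg[of _ _ 2] Eg[of _ _ 3]
  define T where "T y = random_sum (\<xi>0 y) (g y)" for y
  have Tind: "indep_vars (\<lambda>_. borel) T {-K..K}"
  proof -
    \<comment> \<open>All coordinates are real, the count included; \<open>nat\<close> of the floor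
      recovers the number of summands, so the site sum is a measurable function of the block of
      \<open>y\<close> alone.\<close>
    let ?\<Psi> = "\<lambda>y z. \<Sum>i<nat \<lfloor>z (y, 0 :: nat)\<rfloor>. z (y, Suc i) :: real"
    have "indep_vars (\<lambda>y. PiM ({y} \<times> UNIV) (\<lambda>_. borel)) (\<lambda>y \<omega>. restrict (\<lambda>p. U p \<omega>) ({y} \<times> UNIV)) {-K..K}"
      by (rule indep_vars_restrict[OF Uind]) (auto simp: disjoint_family_on_def)
    then have "indep_vars (\<lambda>_. borel) (\<lambda>y \<omega>. ?\<Psi> y (restrict (\<lambda>p. U p \<omega>) ({y} \<times> UNIV))) {-K..K}"
    proof (rule indep_vars_compose2)
      fix y
      show "?\<Psi> y \<in> borel_measurable (PiM ({y} \<times> UNIV) (\<lambda>_. borel))"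
      proof (rule measurable_compose_countable)
        have [measurable]: "(\<lambda>z. z (y, i)) \<in> borel_measurable (PiM ({y} \<times> UNIV) (\<lambda>_. borel :: real measure))" for i :: nat
          by (rule measurable_component_singleton) simp
        show "(\<lambda>z. \<Sum>i<n. z (y, Suc i) :: real) \<in> borel_measurable (PiM ({y} \<times> UNIV) (\<lambda>_. borel))" for n
          by measurable
        show "(\<lambda>z. nat \<lfloor>z (y, 0) :: real\<rfloor>) \<in> measurable (PiM ({y} \<times> UNIV) (\<lambda>_. borel)) (count_space UNIV)"
          by measurable
      qed
    qed
    moreover have "(\<lambda>y \<omega>. ?\<Psi> y (restrict (\<lambda>p. U p \<omega>) ({y} \<times> UNIV))) = T"
      by (simp add: fun_eq_iff T_def random_sum_def partial_sum_def gU) (simp add: U_def)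
    ultimately show ?thesis by simp
  qed
  have Tsum: "T y \<omega> = (\<Sum>i = 1..\<xi>0 y \<omega>. \<phi> (visit_count A N y i \<omega>))" for y \<omega>
    unfolding T_def random_sum_def partial_sum_def g_def
    by (rule sum.reindex_bij_witness[where i="\<lambda>i. i - 1" and j=Suc]) auto
  have v: "lam * ?v = (\<Sum>y = -K..K. variance (T y))"
    unfolding T_def compound_moments(5)[OF mom] by (simp add: m_def sum_distrib_left)
  have "wasserstein M (standardized V) Q Z
    \<le> ereal (16 * (\<Sum>y = -K..K. expectation (\<lambda>\<omega>. \<bar>T y \<omega> - expectation (T y)\<bar> ^ 3)) / sqrt (lam * ?v) ^ 3)"
  proof (rule wasserstein_standardized_indep_sum_le[OF _ Tind _ _ V(1) _ v _ Z])
    show "integrable M (T y)" for y unfolding T_def by (rule compound_moments(1)[OF mom])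
    show "integrable M (\<lambda>\<omega>. \<bar>T y \<omega> - expectation (T y)\<bar> ^ 3)" for y
      unfolding T_def by (rule compound_third_central_moment(1)[OF mom])
    show "AE \<omega> in M. V \<omega> = (\<Sum>y = -K..K. T y \<omega>)" using V(2) by (simp add: Tsum)
    show "0 < lam * ?v" using lam pos by simp
  qed simp
  also have "\<dots> \<le> ereal (16 * (\<Sum>y = -K..K. 2 * (lam * (lam\<^sup>2 + 3 * lam + 1)) * m y 3) / sqrt (lam * ?v) ^ 3)"
    using lam pos unfolding ereal_less_eq T_def
    by (intro divide_right_mono mult_left_mono sum_mono compound_third_central_moment(2)[OF mom]) auto
  also have "\<dots> = ereal (32 * (lam * (lam\<^sup>2 + 3 * lam + 1)) * (\<Sum>y = -K..K. m y 3) / sqrt (lam * ?v) ^ 3)"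
    by (simp add: sum_distrib_left[symmetric])
  finally show ?thesis by (simp add: m_def)
qed

end

theorem theorem1p2:
  fixes lam :: real and A :: "int set"
  assumes "lam > 0" and "finite A" and "A \<noteq> {}"
  shows "\<exists>C\<^sub>1 > 0. \<exists>C\<^sub>2 > 0.
    \<forall>(M :: 'w measure) \<xi>0 X (Q :: 'z measure) Z.
      poisson_walk_field M lam \<xi>0 X \<longrightarrow>
      prob_space Q \<longrightarrow> distributed Q lborel Z std_normal_density \<longrightarrow>
      (\<forall>N\<ge>1. wasserstein M (prob_space.standardized M (cumulative_occupation \<xi>0 X A N)) Q Z
               \<le> ereal (C\<^sub>1 * real N powr (- 1/4))) \<and>
      (\<forall>N\<ge>1. wasserstein M (prob_space.standardized M (distinct_visitors \<xi>0 X A N)) Q Z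
               \<le> ereal (C\<^sub>2 * real N powr (- 1/4)))"
proof -
  define R where "R = Max (abs ` A)"
  have AR: "A \<subseteq> {-R..R}"
  proof
    fix x assume "x \<in> A"
    then have "\<bar>x\<bar> \<le> R" using assms(2) by (auto simp: R_def)
    then show "x \<in> {-R..R}" by auto
  qed
  define c where "c = 32 * (lam * (lam\<^sup>2 + 3 * lam + 1))"
  have c: "c > 0" using assms(1) by (auto simp: c_def intro!: mult_pos_pos add_nonneg_pos)
  have a: "card A > 0" using assms by (simp add: card_gt_0_iff)
  \<comment> \<open>The 13 comes from the upper bound on the total third moment,
    \<open>lam / 4\<close> from the lower bound on the total second moment. The analogous data for
    \<open>?C2\<close> is the hitting bound with its factor 1/3.\<close>
  let ?C1 = "c * (13 * real (card A) ^ 3) / sqrt (lam / 4) ^ 3"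
  let ?C2 = "c * sqrt 3 / sqrt lam ^ 3"
  have powr_quarter: "real N powr (- 1/4) = 1 / sqrt (sqrt N)" if "N \<ge> 1" for N :: nat
  proof -
    have "sqrt (sqrt N) = real N powr (1/4)"
      using that by (simp add: powr_half_sqrt[symmetric] powr_powr)
    then show ?thesis using that by (simp add: powr_minus_divide)
  qed
  show ?thesis
  proof (rule exI[of _ ?C1], intro conjI, use c a assms(1) in simp, rule exI[of _ ?C2], intro conjI, use c assms(1) in simp,
      intro allI impI conjI)
    fix M :: "'w measure" and \<xi>0 X and Q :: "'z measure" and Z and N :: nat
    assume field: "poisson_walk_field M lam \<xi>0 X" and Z: "distributed Q lborel Z std_normal_density" and N: "1 \<le> N"
    interpret poisson_walk_field M lam \<xi>0 X by fact
    \<comment> \<open>Sites at distance \<open>K\<close> or more are too far from \<open>A\<close>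
      to reach it within \<open>N\<close> steps.\<close>
    define K where "K = R + int N + 1"
    let ?v = "\<Sum>y = -K..K. steps_mean N (\<lambda>l. visits A y l ^ 2)"
    let ?w = "\<Sum>y = -K..K. steps_mean N (\<lambda>l. visits A y l ^ 3)"
    \<comment> \<open>In terms of the fourth root of \<open>N\<close> every order is an integer
      power: second moment \<open>q^6\<close>, third moment \<open>q^8\<close>, hits
      \<open>q^2\<close>. The rate is \<open>q^8 / (q^3)^3 = 1 / q\<close>.\<close>
    define q where "q = sqrt (sqrt N)"
    have q: "q > 0" "sqrt N = q\<^sup>2" "real N = q ^ 4"
      using N by (auto simp: q_def) (metis of_nat_0_le_iff power2_eq_square power4_eq_xxxx real_sqrt_ge_zero real_sqrt_pow2 mult.assoc)
    have K1: "K \<ge> R + int N + 1" by (simp add: K_def)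
    have v: "q ^ 6 / 4 \<le> ?v"
    proof -
      have "real N * sqrt N = q ^ 6" unfolding q(2) unfolding q(3) by (simp flip: power_add)
      then show ?thesis using total_visits_2_ge[OF AR assms(3) K1 N] by (simp only: visits_moment_def)
    qed
    have v0: "?v > 0" using v q(1) by (smt (verit) zero_less_power divide_pos_pos)
    have w: "?w \<le> 13 * real (card A) ^ 3 * q ^ 8"
      using total_visits_3_le[OF AR assms(3) K1 N] by (simp add: visits_moment_def q(3) flip: power_mult)
    have "wasserstein M (standardized (cumulative_occupation \<xi>0 X A N)) Q Z \<le> ereal (c * ?w / sqrt (lam * ?v) ^ 3)"
      unfolding c_def
      by (rule wasserstein_particle_sum_le[OF assms(1) _ _ cumulative_occupation_measurable
            cumulative_occupation_eq[OF AR] v0 Z, where B="real N"]) (auto simp: K_def)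
    also have "\<dots> \<le> ereal (c * (13 * real (card A) ^ 3 * q ^ 8) / sqrt (lam * (q ^ 6 / 4)) ^ 3)"
      unfolding ereal_less_eq using c w v assms(1) q(1)
      by (intro frac_le mult_left_mono power_mono real_sqrt_le_mono) auto
    also have "c * (13 * real (card A) ^ 3 * q ^ 8) / sqrt (lam * (q ^ 6 / 4)) ^ 3 = ?C1 * real N powr (- 1/4)"
    proof -
      have "sqrt (lam * (q ^ 6 / 4)) = sqrt (lam / 4) * q ^ 3"
        using q(1) assms(1) by (intro real_sqrt_unique) (auto simp: power_mult_distrib simp flip: power_mult)
      moreover have "q ^ 8 / (s * q ^ 3) ^ 3 = 1 / s ^ 3 * (1 / q)" if "s > 0" for s
        using q(1) that by (simp add: power_mult_distrib field_simps flip: power_mult power_Suc power_add)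
      ultimately show ?thesis
        unfolding powr_quarter[OF N] q_def[symmetric] using assms(1)
        by (simp add: times_divide_eq_right[symmetric] del: times_divide_eq_right)
    qed
    finally show "wasserstein M (standardized (cumulative_occupation \<xi>0 X A N)) Q Z \<le> ereal (?C1 * real N powr (- 1/4))" .

    let ?H = "\<Sum>y = -K..K. steps_mean N (\<lambda>l. of_bool (visits A y l > 0))"
    have H: "q\<^sup>2 / 3 \<le> ?H"
      using total_hits_ge[OF AR assms(3) K1 N] by (simp add: q(2))
    have H0: "?H > 0" using H q(1) by (smt (verit) zero_less_power divide_pos_pos)
    \<comment> \<open>Powers of an indicator coincide, so both moment totals equal
      \<open>?H\<close>.\<close>
    have pw: "(of_bool b :: real) ^ k = of_bool b" if "k > 0" for b k using that by (cases b) auto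
    have "wasserstein M (standardized (distinct_visitors \<xi>0 X A N)) Q Z
      \<le> ereal (c * (\<Sum>y = -K..K. steps_mean N (\<lambda>l. of_bool (visits A y l > 0) ^ 3)) /
         sqrt (lam * (\<Sum>y = -K..K. steps_mean N (\<lambda>l. of_bool (visits A y l > 0) ^ 2))) ^ 3)"
      unfolding c_def
      by (rule wasserstein_particle_sum_le[OF assms(1) _ _ distinct_visitors_measurable
            distinct_visitors_eq[OF AR] _ Z, where B=1]) (use H0 in \<open>auto simp: K_def pw\<close>)
    also have "\<dots> = ereal (c * ?H / sqrt (lam * ?H) ^ 3)" by (simp add: pw)
    also have "\<dots> = ereal (c / sqrt lam ^ 3 / sqrt ?H)"
    proof -
      \<comment> \<open>Taken at the root of \<open>?H\<close>: the numerator cancels against part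
        of the denominator, so a lower bound on \<open>?H\<close> is all that remains to be
        inserted.\<close>
      have "c * (x * x) / (t * x) ^ 3 = c / t ^ 3 / x" if "x > 0" "t > 0" for x t
        using that by (simp add: field_simps power3_eq_cube)
      from this[of "sqrt ?H" "sqrt lam"] show ?thesis
        using H0 assms(1) by (simp add: real_sqrt_mult)
    qed
    also have "\<dots> \<le> ereal (c / sqrt lam ^ 3 / sqrt (q\<^sup>2 / 3))"
      unfolding ereal_less_eq using H c assms(1) q(1)
      by (intro divide_left_mono real_sqrt_le_mono mult_pos_pos) (auto intro: less_le_trans[OF _ H])
    also have "\<dots> = ereal (?C2 * real N powr (- 1/4))"
      unfolding powr_quarter[OF N] q_def[symmetric] using q(1) by (simp add: real_sqrt_divide)
    finally show "wasserstein M (standardized (distinct_visitors \<xi>0 X A N)) Q Z \<le> ereal (?C2 * real N powr (- 1/4))" .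
  qed
qed

end
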